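(* Let $n\geq 3$ and let $P\subset\mathbb{R}^n$ be an admissible $n$-dimensional polytope. Suppose that at least one of the following holds: (1) $P$ is a centered orthotope; (2) $P$ is centrally symmetric ($P=-P$) and every facet $F$ of $P$ satisfies $\operatorname{dist}(0,\operatorname{aff}F)=1$. Then $$\Phi_{n-2}(P)\geq 2^n\binom{n}{2}=n(n-1)2^{n-1}.$$ Equality is attained by $[-1,1]^n$.
   Context: A polytope means a compact convex polyhedron. An $n$-dimensional convex polytope $P\subset\mathbb{R}^n$ is called admissible if $0\in\operatorname{int}P$ and, for every $k\in\{1,\ldots,n\}$, every nonempty proper face $F$ of $P$ of codimension $k$ (i.e. $\dim F=n-k$) satisfies $\operatorname{dist}(0,\operatorname{aff}F)\geq\sqrt{k}$, where $\operatorname{aff}F$ is the affine hull of $F$. A centered orthotope is a rectangular box centered at the origin, i.e. (up to an orthogonal transformation of $\mathbb{R}^n$) a set $\prod_{i=1}^n[-a_i,a_i]$ with all $a_i>0$. The total $(n-2)$-face measure is $\Phi_{n-2}(P)=\sum_{F}\mathcal{H}^{n-2}(F)$, the sum over all $(n-2)$-dimensional faces $F$ of $P$, where $\mathcal{H}^{n-2}$ is $(n-2)$-dimensional Hausdorff measure (Euclidean $(n-2)$-volume in the affine hull of $F$). *)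

theory Defs
  imports "HOL-Analysis.Analysis"
begin

(* codimension k is written out as dimension n - k, in int because of aff_dim *)
definition admissible :: "(real^'n) set \<Rightarrow> bool" where
  "admissible P \<longleftrightarrow>
     polyhedron P \<and> compact P \<and> aff_dim P = int CARD('n) \<and> 0 \<in> interior P \<and>
     (\<forall>k\<in>{1..CARD('n)}. \<forall>F. F face_of P \<and> F \<noteq> {} \<and> F \<noteq> P \<and> aff_dim F = int CARD('n) - int k
        \<longrightarrow> infdist 0 (affine hull F) \<ge> sqrt (real k))"

definition centered_orthotope :: "(real^'n) set \<Rightarrow> bool" where
  "centered_orthotope P \<longleftrightarrow>
     (\<exists>(f :: real^'n \<Rightarrow> real^'n) (a :: real^'n). orthogonal_transformation f \<and> (\<forall>i. a $ i > 0) \<and>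
        P = f ` {x. \<forall>i. - (a $ i) \<le> x $ i \<and> x $ i \<le> a $ i})"

definition symmetric_with_unit_facets :: "(real^'n) set \<Rightarrow> bool" where
  "symmetric_with_unit_facets P \<longleftrightarrow>
     P = uminus ` P \<and> (\<forall>F. F facet_of P \<longrightarrow> infdist 0 (affine hull F) = 1)"

definition standard_cube :: "(real^'n) set" where
  "standard_cube = {x. \<forall>i. -1 \<le> x $ i \<and> x $ i \<le> 1}"

(* \<phi> parametrises the d-dimensional affine subspace A by Cartesian coordinates:
   only the coordinates x 0, ..., x (d - 1) matter. *)
definition cartesian_chart :: "nat \<Rightarrow> 'a::euclidean_space set \<Rightarrow> ((nat \<Rightarrow> real) \<Rightarrow> 'a) \<Rightarrow> bool" where
  "cartesian_chart d A \<phi> \<longleftrightarrow>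
     (\<exists>p b. (\<forall>i<d. \<forall>j<d. b i \<bullet> b j = (if i = j then 1 else 0)) \<and>
        \<phi> = (\<lambda>x. p + (\<Sum>i<d. x i *\<^sub>R b i)) \<and> range \<phi> = A)"

(* The Euclidean d-volume of a set S with d-dimensional affine hull (equivalently, its
   d-dimensional Hausdorff measure, normalised to agree with Lebesgue measure): Lebesgue measure
   on R^d, here the product measure on functions on {..<d}, read off in Cartesian coordinates of
   the affine hull. Two charts of the same affine hull differ by an isometry of R^d, so the
   choice of chart is immaterial. Meaningful only if aff_dim S = d. *)
definition affine_volume :: "nat \<Rightarrow> 'a::euclidean_space set \<Rightarrow> real" where
  "affine_volume d S =
     (let \<phi> = (SOME \<phi>. cartesian_chart d (affine hull S) \<phi>)
      in measure (\<Pi>\<^sub>M i\<in>{..<d}. (lborel :: real measure)) {x \<in> {..<d} \<rightarrow>\<^sub>E UNIV. \<phi> x \<in> S})"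

definition total_face_measure :: "nat \<Rightarrow> 'a::euclidean_space set \<Rightarrow> real" where
  "total_face_measure d P = (\<Sum>F | F face_of P \<and> aff_dim F = int d. affine_volume d F)"

end

theory Submission
  imports Defs
begin

text \<open>For an orthotope the faces of codimension k are found by choosing k coordinates and fixing
each of them to one end of its range. With half-widths a_i, this gives the total face measure
as the sum, over the k-element sets I, of 2^k times the product of 2 a_i over i outside I
(\<open>total_face_measure_orthotope\<close>). Admissibility for facets says that all a_i are at least 1,
and the sum is increasing in the a_i, so it is smallest for the cube, where it equals
2^n (n choose k).

The symmetric case reduces to this one, because the hypotheses leave only rotated cubes
(\<open>admissible_symmetric_imp_rotated_cube\<close>). Let the unit vectors u range over the outer facet
normals of P; since the facets have distance 1, P is cut out by u \<bullet> x \<le> 1, and each u itself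
lies in P. The distance bound \<open>sqrt 2\<close> in codimension two says that normals of adjacent facets
satisfy u \<bullet> v \<le> 0. Consequently every point y of P can be pushed in direction u up to the
facet of u without leaving P (\<open>shift_to_facet_mem\<close>): on the way only inequalities of facets
adjacent to that of u could fail, and their left-hand sides do not increase. Pushing y = v
yields (1 - u \<bullet> v) (u \<bullet> v) \<le> 0, so u \<bullet> v \<le> 0 for all distinct normals, adjacent or not. By
central symmetry the same holds for -u and v. So normals that are not opposite are orthogonal,
and boundedness makes them span the space.

The volumes of faces are defined through an arbitrary chart of the affine hull. They are
computed by thickening a face to a prism of full dimension, where rotation invariance of
Lebesgue measure applies (\<open>affine_volume_eq_measure_prism\<close>).\<close>

section \<open>Polytopes circumscribed about the unit ball\<close>

lemma infdist_0_eqI: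
  fixes m :: "'a::real_normed_vector"
  assumes "m \<in> A" "\<And>x. x \<in> A \<Longrightarrow> norm m \<le> norm x"
  shows "infdist 0 A = norm m"
proof (rule antisym)
  show "infdist 0 A \<le> norm m"
    using infdist_le[OF assms(1), of 0] by simp
  show "norm m \<le> infdist 0 A"
    using assms by (subst infdist_notempty) (auto intro!: cINF_greatest)
qed

text \<open>A segment from a point of a polyhedron to a point of its affine hull outside it has a last
point in the polyhedron. That point lies on the relative boundary, which is the union of the
facets. Applied to a polytope this leads to a facet, applied to a facet it leads to a ridge.\<close>

lemma segment_leaves_polyhedron_through_facet:
  fixes S :: "'a::euclidean_space set"
  assumes S: "polyhedron S" and p: "p \<in> S" and z: "z \<in> affine hull S" "z \<notin> S"
  obtains G t where "G facet_of S" "0 \<le> t" "t < 1" "(1 - t) *\<^sub>R p + t *\<^sub>R z \<in> G"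
proof -
  define w where "w t = (1 - t) *\<^sub>R p + t *\<^sub>R z" for t
  define T where "T = {0..1} \<inter> w -` S"
  have "closed S" "convex S"
    using S polyhedron_imp_closed polyhedron_imp_convex by auto
  have "continuous_on UNIV w"
    unfolding w_def by (intro continuous_intros)
  then have "closed (w -` S)"
    using \<open>closed S\<close> by (simp add: continuous_on_closed_vimage)
  then have "compact T"
    unfolding T_def by (simp add: compact_Int_closed)
  moreover have "0 \<in> T"
    using p by (simp add: T_def w_def)
  ultimately obtain t where t: "t \<in> T" "\<And>s. s \<in> T \<Longrightarrow> s \<le> t"
    using compact_attains_sup[of T] by blast
  then have t01: "0 \<le> t" "t \<le> 1" and wS: "w t \<in> S"
    by (auto simp: T_def)
  have "t \<noteq> 1"
    using wS z(2) by (auto simp: w_def)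
  then have t1: "t < 1"
    using t01 by simp
  have "w t \<notin> rel_interior S"
  proof
    assume ri: "w t \<in> rel_interior S"
    have "2 *\<^sub>R w t - z \<in> affine hull S"
    proof -
      have "w t \<in> affine hull S"
        using wS by (simp add: hull_inc)
      then have "2 *\<^sub>R w t + (-1) *\<^sub>R z \<in> affine hull S"
        by (intro mem_affine[OF affine_affine_hull]) (use z in auto)
      then show ?thesis by simp
    qed
    then obtain e where e: "e > 1" "(1 - e) *\<^sub>R (2 *\<^sub>R w t - z) + e *\<^sub>R w t \<in> S"
      using convex_rel_interior_if2[OF \<open>convex S\<close> ri] by blast
    have eq: "(1 - e) *\<^sub>R (2 *\<^sub>R w t - z) + e *\<^sub>R w t = w t + (e - 1) *\<^sub>R (z - w t)"
      by (simp add: algebra_simps scaleR_2)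
    \<comment> \<open>The point just found may lie beyond z; with this r the step towards it
      stays within the parameter range [0,1].\<close>
    define r where "r = 1 / max 1 (e - 1)"
    have r: "0 < r" "r \<le> 1" "r * (e - 1) \<le> 1"
      by (auto simp: r_def max_def field_simps)
    have "(1 - r) *\<^sub>R w t + r *\<^sub>R (w t + (e - 1) *\<^sub>R (z - w t)) \<in> S"
      using e(2) wS r eq by (intro convexD[OF \<open>convex S\<close>]) auto
    moreover have "(1 - r) *\<^sub>R w t + r *\<^sub>R (w t + (e - 1) *\<^sub>R (z - w t)) = w (t + r * (e - 1) * (1 - t))"
      by (simp add: w_def algebra_simps)
    moreover have "t + r * (e - 1) * (1 - t) \<le> 1"
      using mult_nonneg_nonneg[of "1 - r * (e - 1)" "1 - t"] r(3) t1 by (simp add: algebra_simps)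
    ultimately have "t + r * (e - 1) * (1 - t) \<in> T"
      using r e t01 by (auto simp: T_def)
    then have "r * (e - 1) * (1 - t) \<le> 0"
      using t(2) by fastforce
    then show False
      using r e t1 by (metis diff_gt_0_iff_gt mult_pos_pos not_le)
  qed
  then have "w t \<in> \<Union>{F. F facet_of S}"
    using rel_boundary_of_polyhedron[OF S] wS by blast
  then show ?thesis
    using that t01 t1 unfolding w_def by blast
qed

lemma infdist_0_hyperplane:
  fixes a :: "'a::euclidean_space"
  assumes "a \<noteq> 0" "b \<ge> 0"
  shows "infdist 0 {x. a \<bullet> x = b} = b / norm a"
proof -
  have "infdist 0 {x. a \<bullet> x = b} = norm ((b / (norm a)\<^sup>2) *\<^sub>R a)"
  proof (rule infdist_0_eqI)
    show "(b / (norm a)\<^sup>2) *\<^sub>R a \<in> {x. a \<bullet> x = b}"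
      using assms by (simp add: power2_norm_eq_inner)
  next
    fix x assume "x \<in> {x. a \<bullet> x = b}"
    then have "b \<le> norm a * norm x"
      using norm_cauchy_schwarz[of a x] by simp
    then show "norm ((b / (norm a)\<^sup>2) *\<^sub>R a) \<le> norm x"
      using assms by (simp add: field_simps power2_eq_square)
  qed
  then show ?thesis
    using assms by (simp add: power2_eq_square)
qed

text \<open>For a polytope whose facet hyperplanes all touch the unit sphere, these are exactly the
contact points of the facets with the sphere.\<close>

definition unit_facet_normals :: "'a::euclidean_space set \<Rightarrow> 'a set" where
  "unit_facet_normals P =
     {u. norm u = 1 \<and> P \<subseteq> {x. u \<bullet> x \<le> 1} \<and> P \<inter> {x. u \<bullet> x = 1} facet_of P}"

lemma affine_hull_facet:
  fixes P :: "'a::euclidean_space set"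
  assumes "aff_dim P = DIM('a)" "a \<noteq> 0" "P \<inter> {x. a \<bullet> x = b} facet_of P"
  shows "affine hull (P \<inter> {x. a \<bullet> x = b}) = {x. a \<bullet> x = b}"
proof (rule affine_dim_equal)
  show "affine hull (P \<inter> {x. a \<bullet> x = b}) \<noteq> {}"
    using assms by (auto simp: facet_of_def)
  show "affine hull (P \<inter> {x. a \<bullet> x = b}) \<subseteq> {x. a \<bullet> x = b}"
    by (rule hull_minimal) (auto simp: affine_hyperplane)
  show "aff_dim (affine hull (P \<inter> {x. a \<bullet> x = b})) = aff_dim {x. a \<bullet> x = b}"
    using assms by (simp add: facet_of_def aff_dim_hyperplane)
qed (auto simp: affine_hyperplane)

lemma facet_has_unit_normal:
  fixes P :: "'a::euclidean_space set"
  assumes P: "polyhedron P" "aff_dim P = DIM('a)" "0 \<in> P" and F: "F facet_of P"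
    and dist: "infdist 0 (affine hull F) = 1"
  obtains u where "u \<in> unit_facet_normals P" "F = P \<inter> {x. u \<bullet> x = 1}"
proof -
  obtain a b where ab: "a \<noteq> 0" "P \<subseteq> {x. a \<bullet> x \<le> b}" "F = P \<inter> {x. a \<bullet> x = b}"
    using facet_of_polyhedron[OF P(1) F] by blast
  have "b \<ge> 0"
    using ab(2) P(3) by auto
  have "affine hull F = {x. a \<bullet> x = b}"
    using affine_hull_facet[OF P(2) ab(1)] F ab(3) by simp
  then have "b = norm a"
    using dist infdist_0_hyperplane[OF ab(1) \<open>b \<ge> 0\<close>] ab(1) by (simp add: field_simps)
  define u where "u = a /\<^sub>R norm a"
  have *: "u \<bullet> x \<le> 1 \<longleftrightarrow> a \<bullet> x \<le> b" "u \<bullet> x = 1 \<longleftrightarrow> a \<bullet> x = b" for x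
    using ab(1) \<open>b = norm a\<close> by (auto simp: u_def divide_simps)
  have "F = P \<inter> {x. u \<bullet> x = 1}"
    using ab(3) * by simp
  moreover have "u \<in> unit_facet_normals P"
    using ab * F \<open>F = P \<inter> {x. u \<bullet> x = 1}\<close> by (auto simp: unit_facet_normals_def u_def)
  ultimately show ?thesis
    using that by blast
qed

text \<open>Polytopes with the origin inside and every facet hyperplane at distance one, that is,
polytopes circumscribed about the unit ball.\<close>

locale unit_facet_polytope =
  fixes P :: "'a::euclidean_space set"
  assumes poly: "polyhedron P" and bounded: "bounded P" and full: "aff_dim P = DIM('a)"
    and zero: "0 \<in> P"
    and unit_facets: "\<And>F. F facet_of P \<Longrightarrow> infdist 0 (affine hull F) = 1"
begin

lemma unit_normal_le: "u \<in> unit_facet_normals P \<Longrightarrow> x \<in> P \<Longrightarrow> u \<bullet> x \<le> 1"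
  by (auto simp: unit_facet_normals_def)

text \<open>If x violates no facet inequality, the segment from the origin to x cannot leave the polytope:
at an exit point t x with t < 1 on the facet with normal u, one would have u \<bullet> x > 1.\<close>

lemma mem_iff_unit_normals: "x \<in> P \<longleftrightarrow> (\<forall>u \<in> unit_facet_normals P. u \<bullet> x \<le> 1)"
proof
  assume x: "\<forall>u \<in> unit_facet_normals P. u \<bullet> x \<le> 1"
  show "x \<in> P"
  proof (rule ccontr)
    assume "x \<notin> P"
    moreover have "x \<in> affine hull P"
      using full affine_hull_UNIV aff_dim_eq_full by blast
    ultimately obtain G t where G: "G facet_of P" "0 \<le> t" "t < 1" "(1 - t) *\<^sub>R 0 + t *\<^sub>R x \<in> G"
      using segment_leaves_polyhedron_through_facet[OF poly zero] by metis
    obtain u where u: "u \<in> unit_facet_normals P" "G = P \<inter> {x. u \<bullet> x = 1}"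
      using facet_has_unit_normal[OF poly full zero G(1) unit_facets[OF G(1)]] .
    then have "t * (u \<bullet> x) = 1"
      using G by simp
    moreover have "t * (u \<bullet> x) \<le> t"
      using x u(1) G(2) mult_left_mono[of "u \<bullet> x" 1 t] by simp
    ultimately show False
      using G(3) by simp
  qed
qed (auto simp: unit_normal_le)

text \<open>By Cauchy-Schwarz: the foot of the perpendicular to a facet hyperplane is a unit vector, so it
satisfies every inequality u \<bullet> x \<le> 1. Hence each facet is touched by the unit sphere.\<close>

lemma unit_normals_subset: "unit_facet_normals P \<subseteq> P"
proof
  fix v assume "v \<in> unit_facet_normals P"
  then have "u \<bullet> v \<le> 1" if "u \<in> unit_facet_normals P" for u
    using that norm_cauchy_schwarz[of u v] by (auto simp: unit_facet_normals_def)
  then show "v \<in> P"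
    by (simp add: mem_iff_unit_normals)
qed

text \<open>A vector orthogonal to all facet normals would span a line inside the polytope.\<close>

lemma span_unit_normals: "span (unit_facet_normals P) = UNIV"
proof (rule ccontr)
  assume "span (unit_facet_normals P) \<noteq> UNIV"
  then have "dim (unit_facet_normals P) < DIM('a)"
    by (metis dim_eq_full dim_subset_UNIV le_neq_implies_less)
  then obtain x where x: "x \<noteq> 0" "\<And>y. y \<in> span (unit_facet_normals P) \<Longrightarrow> orthogonal x y"
    using orthogonal_to_subspace_exists by blast
  have "c *\<^sub>R x \<in> P" for c
    unfolding mem_iff_unit_normals using x(2)[OF span_base]
    by (auto simp: orthogonal_def inner_commute)
  moreover obtain B where B: "\<And>y. y \<in> P \<Longrightarrow> norm y \<le> B" "B > 0"
    using bounded bounded_pos by blast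
  ultimately have "norm ((2 * B / norm x) *\<^sub>R x) \<le> B"
    by blast
  then show False
    using x(1) B(2) by simp
qed

end

text \<open>The condition on faces of codimension two says that no dihedral angle is obtuse. Together
with central symmetry it forces all angles to be right.\<close>

locale nonobtuse_unit_facet_polytope = unit_facet_polytope P
  for P :: "'a::euclidean_space set" +
  assumes ridges: "\<And>F. F face_of P \<Longrightarrow> F \<noteq> {} \<Longrightarrow> aff_dim F = int DIM('a) - 2
                      \<Longrightarrow> infdist 0 (affine hull F) \<ge> sqrt 2"
begin

text \<open>The affine hull of a ridge shared by the facets with normals u and v contains the point
(u + v) / (1 + u \<bullet> v), whose squared norm is 2 / (1 + u \<bullet> v). This is at least 2 only if
u \<bullet> v \<le> 0.\<close>

lemma inner_normals_at_ridge:
  assumes u: "u \<in> unit_facet_normals P" and v: "v \<in> unit_facet_normals P" "u \<noteq> v"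
    and G: "G facet_of (P \<inter> {x. u \<bullet> x = 1})" "G \<subseteq> {x. v \<bullet> x = 1}"
  shows "u \<bullet> v \<le> 0"
proof (rule ccontr)
  assume "\<not> u \<bullet> v \<le> 0"
  then have c: "u \<bullet> v > 0"
    by simp
  have n: "norm u = 1" "norm v = 1" "u \<noteq> 0" "v \<noteq> 0"
    using u v by (auto simp: unit_facet_normals_def)
  then have uu: "u \<bullet> u = 1" "v \<bullet> v = 1"
    by (simp_all add: norm_eq_1)
  let ?F = "P \<inter> {x. u \<bullet> x = 1}"
  have F: "?F facet_of P"
    using u by (simp add: unit_facet_normals_def)
  have dimG: "aff_dim G = int DIM('a) - 2" and "G \<noteq> {}" "G \<subseteq> ?F"
    using F G by (auto simp: facet_of_def full dest: face_of_imp_subset)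
  have "G face_of P"
    using F G(1) face_of_trans facet_of_imp_face_of by blast
  have "u \<bullet> v \<noteq> 1"
  proof
    assume "u \<bullet> v = 1"
    then have "(u - v) \<bullet> (u - v) = 0"
      using uu by (simp add: inner_diff inner_commute)
    then show False
      using v(2) by simp
  qed
  let ?A = "{x. u \<bullet> x = 1} \<inter> {x. v \<bullet> x = 1}"
  have "affine hull G = ?A"
  proof (rule affine_dim_equal)
    show "affine hull G \<subseteq> ?A"
      using G(2) \<open>G \<subseteq> ?F\<close> by (intro hull_minimal) (auto simp: affine_hyperplane affine_Int)
    have "\<not> {x. u \<bullet> x = 1} \<subseteq> {x. v \<bullet> x = 1}"
      using \<open>u \<bullet> v \<noteq> 1\<close> uu by (auto simp: inner_commute)
    moreover have "?A \<noteq> {}"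
      using \<open>G \<noteq> {}\<close> G(2) \<open>G \<subseteq> ?F\<close> by blast
    ultimately have "aff_dim ?A = int DIM('a) - 2"
      using aff_dim_affine_Int_hyperplane[OF affine_hyperplane, of u 1 v 1] n
      by (simp add: aff_dim_hyperplane)
    then show "aff_dim (affine hull G) = aff_dim ?A"
      using dimG by simp
  qed (use \<open>G \<noteq> {}\<close> in \<open>auto simp: affine_hyperplane affine_Int\<close>)
  define m where "m = (1 / (1 + u \<bullet> v)) *\<^sub>R (u + v)"
  have "m \<in> ?A"
    using c uu by (simp add: m_def inner_add_right inner_commute[of v u] field_simps)
  then have "sqrt 2 \<le> norm m"
    using ridges[OF \<open>G face_of P\<close> \<open>G \<noteq> {}\<close> dimG] infdist_le[of m "affine hull G" 0]
      \<open>affine hull G = ?A\<close> by auto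
  then have "2 \<le> m \<bullet> m"
    by (simp add: norm_eq_sqrt_inner)
  also have "m \<bullet> m = 2 / (1 + u \<bullet> v)"
    using uu c unfolding m_def
    by (simp add: inner_add inner_commute[of v u] divide_simps)
  finally show False
    using c by (simp add: field_simps)
qed

text \<open>Moving a point of P along u up to the facet hyperplane of u does not leave P. Otherwise the
segment from u to the shifted point z would leave the facet of u through a ridge, shared with
a facet of normal v, so that v \<bullet> z > 1. But u \<bullet> v \<le> 0 by the previous lemma, and moving
in direction u only decreases the inner product with v. So P lies in the half-cylinder below
each of its facets.\<close>

lemma shift_to_facet_mem:
  assumes u: "u \<in> unit_facet_normals P" and y: "y \<in> P"
  shows "y + (1 - u \<bullet> y) *\<^sub>R u \<in> P"
proof (rule ccontr)
  let ?F = "P \<inter> {x. u \<bullet> x = 1}" and ?z = "y + (1 - u \<bullet> y) *\<^sub>R u"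
  assume z: "?z \<notin> P"
  have uu: "norm u = 1" "u \<bullet> u = 1" "u \<noteq> 0"
    using u by (auto simp: unit_facet_normals_def norm_eq_1)
  have F: "?F facet_of P"
    using u by (simp add: unit_facet_normals_def)
  have "?z \<in> affine hull ?F"
    using affine_hull_facet[OF full \<open>u \<noteq> 0\<close> F] uu by (simp add: inner_add_right)
  moreover have "u \<in> ?F"
    using unit_normals_subset u uu by auto
  moreover have "polyhedron ?F"
    using poly F facet_of_imp_face_of face_of_polyhedron_polyhedron by blast
  ultimately obtain G t where G: "G facet_of ?F" "0 \<le> t" "t < 1"
      "(1 - t) *\<^sub>R u + t *\<^sub>R ?z \<in> G"
    using z segment_leaves_polyhedron_through_facet[of ?F u ?z] by blast
  have "G face_of P" "G \<noteq> {}" "G \<noteq> P" "G \<noteq> ?F" "G \<subseteq> ?F"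
    using F G(1) by (auto simp: facet_of_def dest: face_of_trans face_of_imp_subset)
  then obtain H where H: "H facet_of P" "G \<subseteq> H" "H \<noteq> ?F"
    using face_of_polyhedron[OF poly \<open>G face_of P\<close> \<open>G \<noteq> {}\<close> \<open>G \<noteq> P\<close>] by blast
  obtain v where v: "v \<in> unit_facet_normals P" "H = P \<inter> {x. v \<bullet> x = 1}"
    using facet_has_unit_normal[OF poly full zero H(1) unit_facets[OF H(1)]] .
  have c: "u \<bullet> v \<le> 0"
    using inner_normals_at_ridge[OF u v(1) _ G(1)] H v(2) by blast
  have "v \<bullet> ((1 - t) *\<^sub>R u + t *\<^sub>R ?z) = 1"
    using G(4) H(2) v(2) by blast
  then have "(1 - t) * (u \<bullet> v) + t * (v \<bullet> ?z) = 1"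
    by (simp add: inner_add_right inner_commute)
  moreover have "(1 - t) * (u \<bullet> v) \<le> 0"
    using G(3) c by (simp add: mult_nonneg_nonpos)
  moreover have "v \<bullet> ?z \<le> 1"
  proof -
    have "(1 - u \<bullet> y) * (u \<bullet> v) \<le> 0"
      using unit_normal_le[OF u y] c by (simp add: mult_nonneg_nonpos)
    then show ?thesis
      using unit_normal_le[OF v(1) y] by (simp add: inner_add_right inner_commute)
  qed
  moreover have "t * (v \<bullet> ?z) \<le> t"
    using mult_left_mono[OF \<open>v \<bullet> ?z \<le> 1\<close> G(2)] by simp
  ultimately show False
    using G(3) by linarith
qed

text \<open>The angle condition spreads from adjacent facets to all pairs of facets by shifting the
contact point v to the facet of u: the result v + (1 - u \<bullet> v) u still satisfies the
inequality of v, which reads (1 - u \<bullet> v) (u \<bullet> v) \<le> 0.\<close>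

lemma inner_distinct_normals_le_0:
  assumes "u \<in> unit_facet_normals P" "v \<in> unit_facet_normals P" "u \<noteq> v"
  shows "u \<bullet> v \<le> 0"
proof (rule ccontr)
  assume "\<not> u \<bullet> v \<le> 0"
  then have c: "u \<bullet> v > 0" by simp
  have uv: "u \<bullet> u = 1" "v \<bullet> v = 1"
    using assms by (auto simp: unit_facet_normals_def norm_eq_1)
  have "(u - v) \<bullet> (u - v) > 0"
    using assms(3) by simp
  then have "u \<bullet> v < 1"
    using uv by (simp add: inner_diff inner_commute)
  have "v \<bullet> (v + (1 - u \<bullet> v) *\<^sub>R u) \<le> 1"
    using assms shift_to_facet_mem[of u v] unit_normals_subset by (intro unit_normal_le) auto
  then have "(1 - u \<bullet> v) * (u \<bullet> v) \<le> 0"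
    using uv by (simp add: inner_add_right inner_commute)
  then show False
    using c \<open>u \<bullet> v < 1\<close> by (simp add: mult_le_0_iff)
qed

text \<open>By symmetry, -u is a facet normal whenever u is. If v differs from u and from -u, the
previous lemma therefore gives both u \<bullet> v \<le> 0 and - u \<bullet> v \<le> 0. So the normals form an
orthonormal basis together with its negatives.\<close>

lemma symmetric_imp_orthonormal_frame:
  assumes sym: "P = uminus ` P"
  obtains B where "card B = DIM('a)"
    "\<And>b c. b \<in> B \<Longrightarrow> c \<in> B \<Longrightarrow> b \<bullet> c = (if b = c then 1 else 0)"
    "\<And>x. x \<in> P \<longleftrightarrow> (\<forall>b\<in>B. \<bar>b \<bullet> x\<bar> \<le> 1)"
proof -
  let ?U = "unit_facet_normals P"
  have img: "x \<in> uminus ` A \<longleftrightarrow> - x \<in> A" for A and x :: 'a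
    by (metis image_iff minus_minus)
  have mP: "- x \<in> P \<longleftrightarrow> x \<in> P" for x
    using sym img by blast
  have neg: "- u \<in> ?U" if "u \<in> ?U" for u
  proof -
    have "P \<inter> {x. - u \<bullet> x = 1} = uminus ` (P \<inter> {x. u \<bullet> x = 1})"
      by (intro set_eqI) (simp add: img mP)
    moreover have "uminus ` (P \<inter> {x. u \<bullet> x = 1}) facet_of uminus ` P"
      using that face_of_linear_image[of uminus "P \<inter> {x. u \<bullet> x = 1}" P]
        aff_dim_injective_linear_image[of "uminus :: 'a \<Rightarrow> 'a"]
      by (auto simp: unit_facet_normals_def facet_of_def linear_uminus)
    moreover have "- u \<bullet> x \<le> 1" if "x \<in> P" for x
      using unit_normal_le[OF \<open>u \<in> ?U\<close>, of "- x"] mP that by simp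
    ultimately show ?thesis
      using that sym by (auto simp: unit_facet_normals_def)
  qed
  have orth: "u \<bullet> v = 0" if "u \<in> ?U" "v \<in> ?U" "v \<noteq> u" "v \<noteq> - u" for u v
    using inner_distinct_normals_le_0[of u v] inner_distinct_normals_le_0[of "- u" v] neg that
    by auto
  obtain B where B: "B \<subseteq> ?U" "independent B" "?U \<subseteq> span B"
    by (rule maximal_independent_subset)
  have one: "b \<bullet> b = 1" if "b \<in> B" for b
    using B(1) that by (auto simp: unit_facet_normals_def norm_eq_1)
  have spanB: "span B = UNIV"
    using B(3) span_unit_normals by (metis span_mono span_span top.extremum_unique)
  \<comment> \<open>Independence picks at most one normal from each antipodal pair.\<close>
  have noneg: "c \<noteq> - b" if "b \<in> B" "c \<in> B" for b c
  proof
    assume "c = - b"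
    moreover have "b \<noteq> c"
      using \<open>c = - b\<close> one[OF \<open>b \<in> B\<close>] by (metis inner_minus_right one_neq_neg_one)
    ultimately have "b \<in> span (B - {b})"
      using that by (metis Diff_iff minus_minus singletonD span_base span_neg)
    then show False
      using B(2) that by (auto simp: dependent_def)
  qed
  have ip: "b \<bullet> c = (if b = c then 1 else 0)" if "b \<in> B" "c \<in> B" for b c
    using orth[of b c] noneg[of b c] B(1) that one by auto
  have "card B = DIM('a)"
    using B(2) spanB by (metis dim_UNIV dim_eq_card dim_span indep_card_eq_dim_span)
  moreover have "x \<in> P \<longleftrightarrow> (\<forall>b\<in>B. \<bar>b \<bullet> x\<bar> \<le> 1)" for x
  proof
    assume x: "x \<in> P"
    have "\<bar>b \<bullet> x\<bar> \<le> 1" if "b \<in> B" for b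
      using unit_normal_le[of b x] unit_normal_le[of "- b" x] neg B(1) that x by force
    then show "\<forall>b\<in>B. \<bar>b \<bullet> x\<bar> \<le> 1" by blast
  next
    assume x: "\<forall>b\<in>B. \<bar>b \<bullet> x\<bar> \<le> 1"
    have "u \<bullet> x \<le> 1" if u: "u \<in> ?U" for u
    proof -
      have "u \<in> B \<or> - u \<in> B"
      proof (rule ccontr)
        assume "\<not> (u \<in> B \<or> - u \<in> B)"
        then have "orthogonal u b" if "b \<in> B" for b
          using orth[of u b] B(1) u that by (auto simp: orthogonal_def)
        then have "orthogonal u u"
          using orthogonal_to_span[of u B u] spanB by auto
        then show False
          using u by (auto simp: unit_facet_normals_def orthogonal_def)
      qed
      then show ?thesis
        using x by force
    qed
    then show "x \<in> P"
      by (simp add: mem_iff_unit_normals)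
  qed
  ultimately show ?thesis
    using that ip by blast
qed

end

section \<open>Volume of a set in a proper affine subspace\<close>

text \<open>This is the usual argument for uniqueness of Haar measure, written for the image measure M of
Lebesgue measure L under f. With B the unit ball, translation invariance and Fubini turn
M(A) L(B) into the integral over y in A of L({x. y - f x \<in> B}). That set is a translate of a
ball because f preserves norms, so the integral is L(A) L(B), and L(B) cancels.\<close>

lemma lborel_distr_orthogonal_transformation:
  fixes f :: "'a::euclidean_space \<Rightarrow> 'a"
  assumes f: "orthogonal_transformation f"
  shows "distr lborel borel f = lborel"
proof (rule measure_eqI)
  fix A :: "'a set" assume "A \<in> sets (distr lborel borel f)"
  then have A[measurable]: "A \<in> sets borel" by simp
  have lin: "linear f" and bij: "bij f"
    using f orthogonal_transformation_linear orthogonal_transformation_bij by auto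
  have cont: "continuous_on UNIV f"
    using lin by (simp add: linear_continuous_on linear_conv_bounded_linear)
  then have [measurable]: "f \<in> borel \<rightarrow>\<^sub>M borel"
    by (rule borel_measurable_continuous_onI)
  define g where "g = inv f"
  have fg: "f (g y) = y" for y
    using bij by (simp add: g_def bij_is_surj surj_f_inv_f)
  have nf: "norm (f x) = norm x" for x
    using f by (rule orthogonal_transformation_norm)
  define B :: "'a set" where "B = ball 0 1"
  have [measurable]: "B \<in> sets borel"
    by (simp add: B_def)
  have mem_B: "x \<in> B \<longleftrightarrow> norm x < 1" for x
    by (simp add: B_def)
  have shift: "(\<integral>\<^sup>+x. h (c + x) \<partial>lborel) = (\<integral>\<^sup>+x. h x \<partial>lborel)"
    if [measurable]: "h \<in> borel_measurable borel" for h :: "'a \<Rightarrow> ennreal" and c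
    by (subst (2) lborel_distr_plus[of c, symmetric]) (simp add: nn_integral_distr)
  have "emeasure (distr lborel borel f) A = (\<integral>\<^sup>+y. indicator A y \<partial>distr lborel borel f)"
    by simp
  also have "\<dots> = (\<integral>\<^sup>+x. indicator A (f x) \<partial>lborel)"
    by (rule nn_integral_distr) auto
  finally have "emeasure (distr lborel borel f) A * emeasure lborel B
      = (\<integral>\<^sup>+y. (\<integral>\<^sup>+x. indicator A (f x) \<partial>lborel) * indicator B y \<partial>lborel)"
    by (simp add: nn_integral_cmult_indicator)
  also have "\<dots> = (\<integral>\<^sup>+y. (\<integral>\<^sup>+x. indicator A (f x) * indicator B y \<partial>lborel) \<partial>lborel)"
    by (simp add: nn_integral_multc)
  also have "\<dots> = (\<integral>\<^sup>+y. (\<integral>\<^sup>+x. indicator A (f x + y) * indicator B y \<partial>lborel) \<partial>lborel)"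
  proof (rule nn_integral_cong)
    fix y :: 'a
    have "f (g y + x) = f x + y" for x
      using fg lin by (simp add: linear_add)
    then show "(\<integral>\<^sup>+x. indicator A (f x) * indicator B y \<partial>lborel)
        = (\<integral>\<^sup>+x. indicator A (f x + y) * indicator B y \<partial>lborel)"
      using shift[of "\<lambda>x. indicator A (f x) * indicator B y" "g y"] by simp
  qed
  also have "\<dots> = (\<integral>\<^sup>+x. (\<integral>\<^sup>+y. indicator A (f x + y) * indicator B y \<partial>lborel) \<partial>lborel)"
    by (rule lborel_pair.Fubini') measurable
  also have "\<dots> = (\<integral>\<^sup>+x. (\<integral>\<^sup>+y. indicator A y * indicator B (y - f x) \<partial>lborel) \<partial>lborel)"
  proof (rule nn_integral_cong)
    fix x
    show "(\<integral>\<^sup>+y. indicator A (f x + y) * indicator B y \<partial>lborel)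
        = (\<integral>\<^sup>+y. indicator A y * indicator B (y - f x) \<partial>lborel)"
      using shift[of "\<lambda>y. indicator A y * indicator B (y - f x)" "f x"] by simp
  qed
  also have "\<dots> = (\<integral>\<^sup>+y. (\<integral>\<^sup>+x. indicator A y * indicator B (y - f x) \<partial>lborel) \<partial>lborel)"
    by (rule lborel_pair.Fubini') measurable
  also have "\<dots> = (\<integral>\<^sup>+y. indicator A y * emeasure lborel B \<partial>lborel)"
  proof (rule nn_integral_cong)
    fix y
    have "(\<integral>\<^sup>+x. indicator B (y - f x) \<partial>lborel) = (\<integral>\<^sup>+x. indicator B (- x) \<partial>(lborel :: 'a measure))"
    proof -
      have "y - f (g y + x) = - f x" for x
        using fg lin by (simp add: linear_add)
      then have "(\<integral>\<^sup>+x. indicator B (y - f x) \<partial>lborel) = (\<integral>\<^sup>+x. indicator B (- f x) \<partial>lborel)"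
        using shift[of "\<lambda>x. indicator B (y - f x)" "g y"] by simp
      also have "\<dots> = (\<integral>\<^sup>+x. indicator B (- x) \<partial>(lborel :: 'a measure))"
        by (intro nn_integral_cong) (simp add: indicator_def mem_B nf)
      finally show ?thesis .
    qed
    also have "\<dots> = (\<integral>\<^sup>+x. indicator B x \<partial>(lborel :: 'a measure))"
      by (intro nn_integral_cong) (simp add: indicator_def mem_B)
    finally show "(\<integral>\<^sup>+x. indicator A y * indicator B (y - f x) \<partial>lborel) = indicator A y * emeasure lborel B"
      by (simp add: nn_integral_cmult)
  qed
  also have "\<dots> = emeasure lborel A * emeasure lborel B"
    by (simp add: nn_integral_multc)
  finally have eq: "emeasure (distr lborel borel f) A * emeasure lborel B = emeasure lborel A * emeasure lborel B" .
  have "emeasure lborel B \<noteq> 0" "emeasure lborel B \<noteq> \<infinity>"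
    using emeasure_lborel_ball_finite[of "0::'a" 1] content_ball_pos[of 1 "0::'a"]
    by (auto simp: B_def measure_def)
  then show "emeasure (distr lborel borel f) A = emeasure lborel A"
    using eq ennreal_mult_cancel_left[of "emeasure lborel B" "emeasure (distr lborel borel f) A" "emeasure lborel A"]
    by (simp add: mult.commute)
qed simp

lemma measure_orthogonal_image_lborel:
  fixes f :: "'a::euclidean_space \<Rightarrow> 'a"
  assumes f: "orthogonal_transformation f" and S: "S \<in> sets borel"
  shows "measure lborel (f ` S) = measure lborel S"
proof -
  let ?g = "inv f"
  have g: "orthogonal_transformation ?g"
    using f by (rule orthogonal_transformation_inv)
  then have "continuous_on UNIV ?g"
    by (simp add: linear_continuous_on linear_conv_bounded_linear[symmetric] orthogonal_transformation_linear)
  then have [measurable]: "?g \<in> borel \<rightarrow>\<^sub>M borel"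
    by (rule borel_measurable_continuous_onI)
  have "f ` S = ?g -` S"
    by (metis f orthogonal_transformation_bij bij_vimage_eq_inv_image bij_imp_bij_inv inv_inv_eq)
  then show ?thesis
    using S measure_distr[of ?g lborel borel S] lborel_distr_orthogonal_transformation[OF g] by simp
qed

text \<open>An orthonormal basis of the direction space gives a chart. This is what makes the chart
chosen in the definition of \<^const>\<open>affine_volume\<close> a genuine one.\<close>

lemma cartesian_chart_exists:
  fixes S :: "'a::euclidean_space set"
  assumes "aff_dim S = int d"
  shows "\<exists>\<phi>. cartesian_chart d (affine hull S) \<phi>"
proof -
  have "S \<noteq> {}"
    using assms by fastforce
  then obtain p where "p \<in> S"
    by blast
  then have p: "p \<in> affine hull S"
    by (rule hull_inc)
  define V where "V = (\<lambda>x. x - p) ` (affine hull S)"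
  have "subspace V"
    unfolding V_def by (rule affine_diffs_subspace_subtract[OF affine_affine_hull p])
  have "dim V = d"
    using aff_dim_eq_dim_subtract[of p "affine hull S"] p assms by (simp add: V_def)
  obtain B where B: "pairwise orthogonal B" "\<And>x. x \<in> B \<Longrightarrow> norm x = 1" "independent B"
      "card B = d" "span B = V"
    using orthonormal_basis_subspace[OF \<open>subspace V\<close>] \<open>dim V = d\<close> by metis
  have "finite B"
    using B(3) by (rule independent_imp_finite)
  then obtain b where b: "bij_betw b {..<d} B"
    using B(4) ex_bij_betw_nat_finite[of B] by (auto simp: atLeast0LessThan)
  define \<phi> where "\<phi> = (\<lambda>x. p + (\<Sum>i<d. x i *\<^sub>R b i))"
  have "b i \<bullet> b j = (if i = j then 1 else 0)" if "i < d" "j < d" for i j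
  proof -
    have "b i \<in> B" "b j \<in> B" "b i = b j \<longleftrightarrow> i = j"
      using b that by (auto simp: bij_betw_def inj_on_def)
    then show ?thesis
      using B(1,2) by (auto simp: pairwise_def orthogonal_def norm_eq_1)
  qed
  moreover have "range \<phi> = affine hull S"
  proof -
    have "range (\<lambda>x. \<Sum>i<d. x i *\<^sub>R b i) = V"
    proof
      have "b i \<in> V" if "i < d" for i
        using b that B(5) by (auto simp: bij_betw_def intro: span_base)
      then show "range (\<lambda>x. \<Sum>i<d. x i *\<^sub>R b i) \<subseteq> V"
        using \<open>subspace V\<close> by (auto intro!: subspace_sum subspace_scale)
      show "V \<subseteq> range (\<lambda>x. \<Sum>i<d. x i *\<^sub>R b i)"
      proof
        fix v assume "v \<in> V"
        then obtain u where "v = (\<Sum>w\<in>B. u w *\<^sub>R w)"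
          using B(5) span_finite[OF \<open>finite B\<close>] by auto
        also have "\<dots> = (\<Sum>i<d. u (b i) *\<^sub>R b i)"
          using sum.reindex_bij_betw[OF b, of "\<lambda>w. u w *\<^sub>R w"] by simp
        finally show "v \<in> range (\<lambda>x. \<Sum>i<d. x i *\<^sub>R b i)"
          by (intro image_eqI[where x = "\<lambda>i. u (b i)"]) auto
      qed
    qed
    then have "range \<phi> = (\<lambda>v. p + v) ` V"
      by (auto simp: \<phi>_def)
    also have "\<dots> = affine hull S"
      by (force simp: V_def image_image)
    finally show ?thesis .
  qed
  ultimately have "cartesian_chart d (affine hull S) \<phi>"
    unfolding cartesian_chart_def \<phi>_def by blast
  then show ?thesis by blast
qed

interpretation lborel_product: product_sigma_finite "\<lambda>_. lborel :: real measure"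
  by unfold_locales

lemma measurable_combination [measurable]:
  fixes p :: "'a::euclidean_space"
  shows "(\<lambda>x. p + (\<Sum>i<d. x i *\<^sub>R b i)) \<in> borel_measurable (\<Pi>\<^sub>M i\<in>{..<d}. (lborel :: real measure))"
proof -
  have "(\<lambda>x. x i) \<in> borel_measurable (\<Pi>\<^sub>M i\<in>{..<d}. (lborel :: real measure))" if "i < d" for i
    using measurable_component_singleton[of i "{..<d}" "\<lambda>_. lborel :: real measure"] that by simp
  then show ?thesis
    by (intro borel_measurable_add borel_measurable_sum borel_measurable_scaleR) auto
qed

lemma distr_PiM_Basis_enumeration:
  fixes e :: "nat \<Rightarrow> 'a::euclidean_space"
  assumes e: "bij_betw e {..<DIM('a)} Basis"
  shows "distr (\<Pi>\<^sub>M i\<in>{..<DIM('a)}. (lborel :: real measure)) borel (\<lambda>x. \<Sum>i<DIM('a). x i *\<^sub>R e i) = lborel"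
proof (rule lborel_eqI[symmetric])
  let ?n = "DIM('a)"
  let ?M = "\<Pi>\<^sub>M i\<in>{..<?n}. (lborel :: real measure)"
  let ?h = "\<lambda>x. \<Sum>i<?n. x i *\<^sub>R e i"
  fix l u :: 'a assume lu: "\<And>b. b \<in> Basis \<Longrightarrow> l \<bullet> b \<le> u \<bullet> b"
  have eB: "e i \<in> Basis" if "i < ?n" for i
    using e that by (auto simp: bij_betw_def)
  have ee: "e i \<bullet> e j = (if i = j then 1 else 0)" if "i < ?n" "j < ?n" for i j
    using e that eB by (auto simp: bij_betw_def inj_on_def inner_Basis)
  have coord: "?h x \<bullet> e j = x j" if "j < ?n" for x j
    using that by (simp add: inner_sum_left ee if_distrib[of "\<lambda>c. _ * c"] cong: if_cong)
  have "?h x \<in> box l u \<longleftrightarrow> (\<forall>i<?n. l \<bullet> e i < x i \<and> x i < u \<bullet> e i)" for x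
  proof -
    have "?h x \<in> box l u \<longleftrightarrow> (\<forall>b\<in>e ` {..<?n}. l \<bullet> b < ?h x \<bullet> b \<and> ?h x \<bullet> b < u \<bullet> b)"
      using e by (simp add: mem_box bij_betw_def)
    then show ?thesis by (auto simp: coord)
  qed
  then have eq: "?h -` box l u \<inter> space ?M = (\<Pi>\<^sub>E i\<in>{..<?n}. {l \<bullet> e i <..< u \<bullet> e i})"
    by (auto simp: space_PiM PiE_def Pi_def)
  have [measurable]: "?h \<in> borel_measurable ?M"
    using measurable_combination[of 0 e ?n] by simp
  have "emeasure (distr ?M borel ?h) (box l u) = emeasure ?M (\<Pi>\<^sub>E i\<in>{..<?n}. {l \<bullet> e i <..< u \<bullet> e i})"
    by (subst emeasure_distr) (auto simp: eq)
  also have "\<dots> = (\<Prod>i<?n. emeasure lborel {l \<bullet> e i <..< u \<bullet> e i})"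
    by (rule lborel_product.emeasure_PiM) auto
  also have "\<dots> = (\<Prod>i<?n. ennreal ((u - l) \<bullet> e i))"
    using lu eB by (intro prod.cong) (auto simp: inner_diff_left)
  also have "\<dots> = (\<Prod>b\<in>Basis. ennreal ((u - l) \<bullet> b))"
    using prod.reindex_bij_betw[OF e, of "\<lambda>b. ennreal ((u - l) \<bullet> b)"] .
  also have "\<dots> = ennreal (\<Prod>b\<in>Basis. (u - l) \<bullet> b)"
    using lu by (intro prod_ennreal) (auto simp: inner_diff_left)
  finally show "emeasure (distr ?M borel ?h) (box l u) = ennreal (\<Prod>b\<in>Basis. (u - l) \<bullet> b)" .
qed simp

text \<open>Cartesian coordinates with respect to any orthonormal frame preserve Lebesgue measure: such a
coordinate map is the one for an enumeration of the standard basis, followed by an orthogonal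
transformation and a translation.\<close>

lemma distr_PiM_orthonormal_frame:
  fixes b :: "nat \<Rightarrow> 'a::euclidean_space"
  assumes b: "\<And>i j. i < DIM('a) \<Longrightarrow> j < DIM('a) \<Longrightarrow> b i \<bullet> b j = (if i = j then 1 else 0)"
  shows "distr (\<Pi>\<^sub>M i\<in>{..<DIM('a)}. (lborel :: real measure)) borel (\<lambda>x. p + (\<Sum>i<DIM('a). x i *\<^sub>R b i)) = lborel"
proof -
  let ?n = "DIM('a)"
  let ?M = "\<Pi>\<^sub>M i\<in>{..<?n}. (lborel :: real measure)"
  obtain e where e: "bij_betw e {..<?n} (Basis :: 'a set)"
    using ex_bij_betw_nat_finite[OF finite_Basis] by (metis atLeast0LessThan)
  let ?h = "\<lambda>x. \<Sum>i<?n. x i *\<^sub>R e i"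
  have eB: "e i \<in> Basis" if "i < ?n" for i
    using e that by (auto simp: bij_betw_def)
  have ee: "e i \<bullet> e j = (if i = j then 1 else 0)" if "i < ?n" "j < ?n" for i j
    using e that eB by (auto simp: bij_betw_def inj_on_def inner_Basis)
  define f where "f y = (\<Sum>i<?n. (y \<bullet> e i) *\<^sub>R b i)" for y
  have fh: "f (?h x) = (\<Sum>i<?n. x i *\<^sub>R b i)" for x
    unfolding f_def by (intro sum.cong) (simp_all add: inner_sum_left ee if_distrib[of "\<lambda>c. _ * c"] cong: if_cong)
  have f: "orthogonal_transformation f"
    unfolding orthogonal_transformation_def
  proof (intro conjI allI)
    show "linear f"
      by (rule linearI) (simp_all add: f_def inner_add_left scaleR_add_left sum.distrib scaleR_sum_right)
    fix v w
    have "f v \<bullet> f w = (\<Sum>i<?n. (v \<bullet> e i) * (w \<bullet> e i))"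
      by (simp add: f_def inner_sum_left inner_sum_right b if_distrib[of "\<lambda>c. _ * c"] mult.commute cong: if_cong)
    also have "\<dots> = (\<Sum>c\<in>Basis. (v \<bullet> c) * (w \<bullet> c))"
      using sum.reindex_bij_betw[OF e, of "\<lambda>c. (v \<bullet> c) * (w \<bullet> c)"] .
    finally show "f v \<bullet> f w = v \<bullet> w"
      by (simp add: euclidean_inner[of v w])
  qed
  have "continuous_on UNIV f"
    using f by (simp add: linear_continuous_on linear_conv_bounded_linear[symmetric] orthogonal_transformation_linear)
  then have [measurable]: "f \<in> borel \<rightarrow>\<^sub>M borel"
    by (rule borel_measurable_continuous_onI)
  have [measurable]: "?h \<in> borel_measurable ?M"
    using measurable_combination[of 0 e ?n] by simp
  have "distr ?M borel (\<lambda>x. p + (\<Sum>i<?n. x i *\<^sub>R b i)) = distr ?M borel ((+) p \<circ> (f \<circ> ?h))"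
    by (simp add: comp_def fh)
  also have "\<dots> = distr (distr (distr ?M borel ?h) borel f) borel ((+) p)"
    by (simp add: distr_distr)
  finally show ?thesis
    by (simp add: distr_PiM_Basis_enumeration[OF e] lborel_distr_orthogonal_transformation[OF f] lborel_distr_plus)
qed

text \<open>The d-volume of S does not depend on the chart and can be read off in full dimension: thicken
S to a prism Q by unit intervals in orthonormal directions N normal to it. Any chart of the
affine hull extends by N to an orthonormal frame of the whole space, whose coordinates carry
Lebesgue measure to Lebesgue measure and split Q into the preimage of S under the chart
times a unit cube.\<close>

lemma affine_volume_eq_measure_prism:
  fixes S :: "'a::euclidean_space set" and N :: "nat \<Rightarrow> 'a"
  assumes dim: "aff_dim S = int d" "d + k = DIM('a)" and S: "S \<in> sets borel"
    and N: "\<And>i j. i < k \<Longrightarrow> j < k \<Longrightarrow> N i \<bullet> N j = (if i = j then 1 else 0)"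
    and perp: "\<And>x y j. x \<in> affine hull S \<Longrightarrow> y \<in> affine hull S \<Longrightarrow> j < k \<Longrightarrow> N j \<bullet> x = N j \<bullet> y"
    and Q: "Q \<in> sets borel"
      "Q = {s + (\<Sum>j<k. t j *\<^sub>R N j) | s t. s \<in> S \<and> (\<forall>j<k. 0 \<le> t j \<and> t j \<le> 1)}"
  shows "affine_volume d S = measure lborel Q"
proof -
  define \<phi> where "\<phi> = (SOME \<phi>. cartesian_chart d (affine hull S) \<phi>)"
  have "cartesian_chart d (affine hull S) \<phi>"
    unfolding \<phi>_def using cartesian_chart_exists[OF dim(1)] by (rule someI_ex)
  then obtain p b where b: "\<And>i j. i < d \<Longrightarrow> j < d \<Longrightarrow> b i \<bullet> b j = (if i = j then 1 else 0)"
    and \<phi>: "\<phi> = (\<lambda>x. p + (\<Sum>i<d. x i *\<^sub>R b i))" and range: "range \<phi> = affine hull S"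
    unfolding cartesian_chart_def by blast
  have \<phi>_in: "\<phi> x \<in> affine hull S" for x
    using range by blast
  have bN: "N j \<bullet> b i = 0" if "i < d" "j < k" for i j
  proof -
    have "\<phi> (\<lambda>l. if l = i then 1 else 0) = p + b i" "\<phi> (\<lambda>_. 0) = p"
      using that by (simp_all add: \<phi> if_distrib[of "\<lambda>c. c *\<^sub>R _"] sum.delta cong: if_cong)
    then have "N j \<bullet> (p + b i) = N j \<bullet> p"
      using perp[OF \<phi>_in \<phi>_in that(2)] by metis
    then show ?thesis by (simp add: inner_add_right)
  qed
  define c where "c i = (if i < d then b i else N (i - d))" for i
  define \<Psi> where "\<Psi> x = p + (\<Sum>i<d + k. x i *\<^sub>R c i)" for x
  have split: "(\<Sum>i<d + k. g i) = (\<Sum>i<d. g i) + (\<Sum>j<k. g (d + j))" for g :: "nat \<Rightarrow> 'a"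
    by (induction k) (simp_all add: add.assoc)
  have \<Psi>: "\<Psi> x = \<phi> x + (\<Sum>j<k. x (d + j) *\<^sub>R N j)" for x
    by (simp add: \<Psi>_def split c_def \<phi> add.assoc)
  have frame: "c i \<bullet> c j = (if i = j then 1 else 0)" if "i < d + k" "j < d + k" for i j
    using that b[of i j] N[of "i - d" "j - d"] bN[of i "j - d"] bN[of j "i - d"]
    by (auto simp: c_def inner_commute)
  have mem: "\<Psi> x \<in> Q \<longleftrightarrow> \<phi> x \<in> S \<and> (\<forall>j<k. 0 \<le> x (d + j) \<and> x (d + j) \<le> 1)" for x
  proof
    assume "\<Psi> x \<in> Q"
    then obtain s t where st: "\<Psi> x = s + (\<Sum>j<k. t j *\<^sub>R N j)" "s \<in> S" "\<forall>j<k. 0 \<le> t j \<and> t j \<le> 1"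
      using Q(2) by blast
    have tx: "t j = x (d + j)" if "j < k" for j
    proof -
      have "N j \<bullet> \<phi> x = N j \<bullet> s"
        using perp[OF \<phi>_in _ that] st(2) hull_inc by metis
      moreover have "N j \<bullet> (\<phi> x + (\<Sum>j<k. x (d + j) *\<^sub>R N j)) = N j \<bullet> (s + (\<Sum>j<k. t j *\<^sub>R N j))"
        using st(1) \<Psi> by simp
      ultimately show ?thesis
        using that by (simp add: inner_add_right inner_sum_right N if_distrib[of "\<lambda>c. _ * c"] sum.delta cong: if_cong)
    qed
    then have "(\<Sum>j<k. x (d + j) *\<^sub>R N j) = (\<Sum>j<k. t j *\<^sub>R N j)"
      by (intro sum.cong) auto
    then have "\<phi> x = s"
      using st(1) \<Psi> by simp
    then show "\<phi> x \<in> S \<and> (\<forall>j<k. 0 \<le> x (d + j) \<and> x (d + j) \<le> 1)"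
      using st tx by simp
  next
    assume "\<phi> x \<in> S \<and> (\<forall>j<k. 0 \<le> x (d + j) \<and> x (d + j) \<le> 1)"
    then show "\<Psi> x \<in> Q"
      unfolding Q(2) \<Psi> by (intro CollectI exI[of _ "\<phi> x"] exI[of _ "\<lambda>j. x (d + j)"]) simp
  qed
  let ?I = "{..<d}" and ?J = "{d..<d + k}"
  let ?M = "\<lambda>I. \<Pi>\<^sub>M i\<in>I. (lborel :: real measure)"
  define T where "T = {x \<in> ?I \<rightarrow>\<^sub>E UNIV. \<phi> x \<in> S}"
  define C where "C = (\<Pi>\<^sub>E i\<in>?J. {0..1::real})"
  have IJ: "?I \<union> ?J = {..<d + k}" "?I \<inter> ?J = {}"
    by auto
  have T: "T \<in> sets (?M ?I)"
  proof -
    have "\<phi> -` S \<inter> space (?M ?I) \<in> sets (?M ?I)"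
      using S unfolding \<phi> by (intro measurable_sets[OF measurable_combination]) auto
    moreover have "\<phi> -` S \<inter> space (?M ?I) = T"
      by (auto simp: T_def space_PiM)
    ultimately show ?thesis by simp
  qed
  have C: "C \<in> sets (?M ?J)"
    unfolding C_def by (intro sets_PiM_I_finite) auto
  have meas\<Psi>: "\<Psi> \<in> borel_measurable (?M {..<d + k})"
    unfolding \<Psi>_def by (rule measurable_combination)
  interpret J: sigma_finite_measure "?M ?J"
    by (rule lborel_product.sigma_finite) simp
  have "emeasure lborel Q = emeasure (distr (?M {..<d + k}) borel \<Psi>) Q"
    using distr_PiM_orthonormal_frame[of c p] frame dim(2) by (simp add: \<Psi>_def[abs_def])
  also have "\<dots> = emeasure (?M {..<d + k}) (\<Psi> -` Q \<inter> space (?M {..<d + k}))"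
    using Q(1) meas\<Psi> by (intro emeasure_distr) auto
  also have "?M {..<d + k} = distr (?M ?I \<Otimes>\<^sub>M ?M ?J) (?M {..<d + k}) (merge ?I ?J)"
    using lborel_product.distr_merge[of ?I ?J] IJ by simp
  also have "emeasure \<dots> (\<Psi> -` Q \<inter> space \<dots>)
      = emeasure (?M ?I \<Otimes>\<^sub>M ?M ?J) (merge ?I ?J -` (\<Psi> -` Q \<inter> space (?M {..<d + k})) \<inter> space (?M ?I \<Otimes>\<^sub>M ?M ?J))"
    using measurable_sets[OF meas\<Psi>, of Q] Q(1) measurable_merge[of ?I ?J "\<lambda>_. lborel :: real measure"] IJ
    by (subst emeasure_distr) simp_all
  also have "merge ?I ?J -` (\<Psi> -` Q \<inter> space (?M {..<d + k})) \<inter> space (?M ?I \<Otimes>\<^sub>M ?M ?J) = T \<times> C"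
  proof -
    have "\<phi> (merge ?I ?J (x, y)) = \<phi> x" for x y
      by (simp add: \<phi> merge_def)
    moreover have "merge ?I ?J (x, y) i = y i" if "d \<le> i" "i < d + k" for x y :: "nat \<Rightarrow> real" and i
      using that by (simp add: merge_def)
    moreover have "(\<forall>j<k. 0 \<le> y (d + j) \<and> y (d + j) \<le> 1) \<longleftrightarrow> (\<forall>i\<in>?J. 0 \<le> y i \<and> y i \<le> 1)" for y :: "nat \<Rightarrow> real"
      by (metis atLeastLessThan_iff le_Suc_ex nat_add_left_cancel_less le_add1)
    moreover have "merge ?I ?J (x, y) \<in> space (?M {..<d + k})" for x y :: "nat \<Rightarrow> real"
      by (auto simp: space_PiM merge_def PiE_def extensional_def)
    ultimately show ?thesis
      by (auto simp: T_def C_def space_pair_measure mem space_PiM PiE_def Pi_def)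
  qed
  also have "emeasure (?M ?I \<Otimes>\<^sub>M ?M ?J) (T \<times> C) = emeasure (?M ?I) T * emeasure (?M ?J) C"
    using T C by (rule J.emeasure_pair_measure_Times)
  also have "emeasure (?M ?J) C = 1"
    unfolding C_def by (subst lborel_product.emeasure_PiM) auto
  finally have "measure lborel Q = measure (?M ?I) T"
    by (simp add: measure_def)
  then show ?thesis
    by (simp add: affine_volume_def \<phi>_def[symmetric] T_def Let_def)
qed

section \<open>Faces of an orthotope\<close>

definition orthobox :: "real^'n \<Rightarrow> (real^'n) set" where
  "orthobox a = {x. \<forall>i. - (a $ i) \<le> x $ i \<and> x $ i \<le> a $ i}"

abbreviation signs :: "'n set \<Rightarrow> ('n \<Rightarrow> real) set" where
  "signs I \<equiv> I \<rightarrow>\<^sub>E {-1, 1}"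

definition box_face :: "real^'n \<Rightarrow> 'n set \<Rightarrow> ('n \<Rightarrow> real) \<Rightarrow> (real^'n) set" where
  "box_face a I c = {x \<in> orthobox a. \<forall>i\<in>I. x $ i = c i * a $ i}"

definition face_center :: "real^'n \<Rightarrow> 'n set \<Rightarrow> ('n \<Rightarrow> real) \<Rightarrow> real^'n" where
  "face_center a I c = (\<chi> i. if i \<in> I then c i * a $ i else 0)"

lemma orthobox_eq_cbox: "orthobox a = cbox (- a) a"
  by (auto simp: orthobox_def mem_box_cart)

lemma sign_cases: "c \<in> signs I \<Longrightarrow> i \<in> I \<Longrightarrow> c i = -1 \<or> c i = 1"
  by (auto dest: PiE_mem)

context
  fixes a :: "real^'n"
  assumes a: "\<And>i. 0 < a $ i"
begin

lemma face_center_mem: "c \<in> signs I \<Longrightarrow> face_center a I c \<in> box_face a I c"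
  using a less_imp_le[OF a] by (auto simp: box_face_def orthobox_def face_center_def dest!: sign_cases)

lemma box_face_face_of:
  assumes "c \<in> signs I"
  shows "box_face a I c face_of orthobox a"
  unfolding face_of_def
proof (intro conjI ballI impI)
  show "box_face a I c \<subseteq> orthobox a"
    by (auto simp: box_face_def)
  show "convex (box_face a I c)"
  proof -
    have "box_face a I c = orthobox a \<inter> (\<Inter>i\<in>I. {x. axis i 1 \<bullet> x = c i * a $ i})"
      by (auto simp: box_face_def inner_axis')
    then show ?thesis
      by (simp add: orthobox_eq_cbox convex_Int convex_INT convex_hyperplane)
  qed
  fix p q x
  assume pq: "p \<in> orthobox a" "q \<in> orthobox a" and x: "x \<in> box_face a I c" "x \<in> open_segment p q"
  then obtain u where u: "0 < u" "u < 1" "x = (1 - u) *\<^sub>R p + u *\<^sub>R q"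
    by (auto simp: in_segment)
  have "p $ i = c i * a $ i \<and> q $ i = c i * a $ i" if "i \<in> I" for i
  proof -
    have ci: "c i = -1 \<or> c i = 1"
      using sign_cases[OF assms that] .
    have "c i * p $ i \<le> a $ i" "c i * q $ i \<le> a $ i"
      using ci pq by (auto simp: orthobox_def minus_le_iff)
    moreover have "(1 - u) * (a $ i - c i * p $ i) + u * (a $ i - c i * q $ i) = 0"
    proof -
      have "(1 - u) * p $ i + u * q $ i = c i * a $ i"
        using x(1) u(3) that by (auto simp: box_face_def)
      then have "c i * ((1 - u) * p $ i + u * q $ i) = a $ i"
        using ci by auto
      then show ?thesis by (simp add: algebra_simps)
    qed
    ultimately have "c i * p $ i = a $ i" "c i * q $ i = a $ i"
      using u by (auto simp: add_nonneg_eq_0_iff)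
    then show ?thesis
      using ci by auto
  qed
  then show "p \<in> box_face a I c" "q \<in> box_face a I c"
    using pq by (auto simp: box_face_def)
qed

text \<open>A face is determined by the box constraints that are tight at one of its relative interior
points g. Coordinates tight at g are constant on the face, because a segment in the face can
be prolonged beyond g. Conversely, from a point x of the box agreeing with g in these
coordinates one can pass through g and a little beyond without leaving the box, so x lies in
the face.\<close>

lemma face_of_orthobox_imp_box_face:
  assumes F: "F face_of orthobox a" "F \<noteq> {}"
  obtains I c where "c \<in> signs I" "F = box_face a I c"
proof -
  have "convex F" "F \<subseteq> orthobox a"
    using F(1) by (auto dest: face_of_imp_convex face_of_imp_subset)
  then obtain g where g: "g \<in> rel_interior F"
    using F(2) rel_interior_eq_empty by blast
  then have "g \<in> F"
    using rel_interior_subset by blast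
  then have gb: "- a $ i \<le> g $ i" "g $ i \<le> a $ i" for i
    using \<open>F \<subseteq> orthobox a\<close> by (auto simp: orthobox_def)
  define I where "I = {i. \<bar>g $ i\<bar> = a $ i}"
  define c where "c = restrict (\<lambda>i. g $ i / a $ i) I"
  have c: "c \<in> signs I"
    using a less_imp_neq[OF a] by (auto simp: c_def I_def field_simps abs_if split: if_splits)
  have cg: "c i * a $ i = g $ i" if "i \<in> I" for i
    using a[of i] that by (simp add: c_def)
  have "F \<subseteq> box_face a I c"
  proof
    fix x assume x: "x \<in> F"
    obtain e where e: "e > 1" "(1 - e) *\<^sub>R x + e *\<^sub>R g \<in> F"
      using convex_rel_interior_iff[OF \<open>convex F\<close> F(2)] g x by blast
    have "x $ i = g $ i" if iI: "i \<in> I" for i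
    proof -
      have xb: "- a $ i \<le> x $ i" "x $ i \<le> a $ i"
        using x \<open>F \<subseteq> orthobox a\<close> by (auto simp: orthobox_def)
      have yb: "- a $ i \<le> (1 - e) * x $ i + e * g $ i" "(1 - e) * x $ i + e * g $ i \<le> a $ i"
        using e(2) \<open>F \<subseteq> orthobox a\<close> by (auto simp: orthobox_def dest!: subsetD)
      have y: "(1 - e) * x $ i + e * g $ i = g $ i + (e - 1) * (g $ i - x $ i)"
        by (simp add: algebra_simps)
      consider "g $ i = a $ i" | "g $ i = - a $ i"
        using iI by (auto simp: I_def abs_if split: if_splits)
      then show ?thesis
      proof cases
        case 1
        then have "(e - 1) * (g $ i - x $ i) \<le> 0"
          using yb y by simp
        then show ?thesis
          using 1 xb e(1) by (auto simp: mult_le_0_iff)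
      next
        case 2
        then have "0 \<le> (e - 1) * (g $ i - x $ i)"
          using yb y by simp
        then show ?thesis
          using 2 xb e(1) by (auto simp: zero_le_mult_iff)
      qed
    qed
    then show "x \<in> box_face a I c"
      using x \<open>F \<subseteq> orthobox a\<close> cg by (auto simp: box_face_def)
  qed
  moreover have "box_face a I c \<subseteq> F"
  proof
    fix x assume x: "x \<in> box_face a I c"
    have xI: "x $ i = g $ i" if "i \<in> I" for i
      using x that cg by (simp add: box_face_def)
    have xb: "- a $ i \<le> x $ i" "x $ i \<le> a $ i" for i
      using x by (auto simp: box_face_def orthobox_def)
    show "x \<in> F"
    proof (cases "x = g")
      case False
      \<comment> \<open>Prolonging from x through g by the factor s moves each coordinate by at most
        2 s times its half-width, which uses up at most the slack left at g.\<close>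
      define s where "s = Min (insert 1 ((\<lambda>i. (a $ i - \<bar>g $ i\<bar>) / (2 * a $ i)) ` (- I)))"
      have s: "0 < s" "\<And>i. i \<notin> I \<Longrightarrow> s \<le> (a $ i - \<bar>g $ i\<bar>) / (2 * a $ i)"
      proof -
        have "0 < (a $ i - \<bar>g $ i\<bar>) / (2 * a $ i)" if "i \<notin> I" for i
          using that gb[of i] a[of i] by (auto simp: I_def abs_if split: if_splits)
        then show "0 < s"
          by (auto simp: s_def)
        show "s \<le> (a $ i - \<bar>g $ i\<bar>) / (2 * a $ i)" if "i \<notin> I" for i
          using that by (auto simp: s_def intro!: Min_le)
      qed
      define y where "y = g + s *\<^sub>R (g - x)"
      have "y \<in> orthobox a"
      proof -
        have "- a $ i \<le> y $ i \<and> y $ i \<le> a $ i" for i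
        proof (cases "i \<in> I")
          case True
          then show ?thesis
            using xI gb by (simp add: y_def)
        next
          case False
          have "\<bar>g $ i - x $ i\<bar> \<le> 2 * a $ i"
            using gb[of i] xb[of i] by (simp add: abs_le_iff)
          then have "s * \<bar>g $ i - x $ i\<bar> \<le> s * (2 * a $ i)"
            using s(1) by (intro mult_left_mono) auto
          also have "\<dots> \<le> a $ i - \<bar>g $ i\<bar>"
            using s(2)[OF False] a[of i] by (simp add: pos_le_divide_eq)
          finally have "\<bar>s * (g $ i - x $ i)\<bar> \<le> a $ i - \<bar>g $ i\<bar>"
            using s(1) by (simp add: abs_mult)
          then show ?thesis
            by (simp add: y_def abs_le_iff) linarith
        qed
        then show ?thesis
          by (simp add: orthobox_def)
      qed
      have "g \<in> open_segment x y"
      proof -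
        have "g = (1 - 1 / (1 + s)) *\<^sub>R x + (1 / (1 + s)) *\<^sub>R y"
        proof -
          have "(1 + s) *\<^sub>R ((1 - 1 / (1 + s)) *\<^sub>R x + (1 / (1 + s)) *\<^sub>R y) = s *\<^sub>R x + y"
            using s(1) by (simp add: algebra_simps scaleR_add_right divide_simps)
          also have "\<dots> = (1 + s) *\<^sub>R g"
            by (simp add: y_def algebra_simps)
          finally show ?thesis
            using s(1) by simp
        qed
        moreover have "x \<noteq> y"
        proof
          assume "x = y"
          then have "(1 + s) *\<^sub>R (g - x) = 0"
            by (simp add: y_def algebra_simps)
          then show False
            using s(1) False by simp
        qed
        ultimately show ?thesis
          using s(1) unfolding in_segment by (intro conjI exI[of _ "1 / (1 + s)"]) auto
      qed
      then show ?thesis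
        using face_ofD[OF F(1)] \<open>y \<in> orthobox a\<close> \<open>g \<in> F\<close> x by (auto simp: box_face_def)
    qed (use \<open>g \<in> F\<close> in simp)
  qed
  ultimately show ?thesis
    using that c by blast
qed

lemma affine_hull_box_face:
  assumes c: "c \<in> signs I"
  shows "affine hull (box_face a I c) = {x. \<forall>i\<in>I. x $ i = c i * a $ i}" (is "_ = ?A")
proof
  have "affine ?A"
  proof -
    have "?A = (\<Inter>i\<in>I. {x. axis i 1 \<bullet> x = c i * a $ i})"
      by (auto simp: inner_axis')
    then show ?thesis
      by (auto intro!: affine_Inter simp: affine_hyperplane)
  qed
  then show "affine hull (box_face a I c) \<subseteq> ?A"
    by (intro hull_minimal) (auto simp: box_face_def)
  show "?A \<subseteq> affine hull (box_face a I c)"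
  proof
    fix x assume x: "x \<in> ?A"
    let ?m = "face_center a I c"
    \<comment> \<open>Scaling by s about the centre of the face brings x into the box.\<close>
    define s where "s = Min (range (\<lambda>i. a $ i / (1 + \<bar>x $ i\<bar>)))"
    have s: "0 < s" "s \<le> a $ i / (1 + \<bar>x $ i\<bar>)" for i
      using a by (auto simp: s_def add_pos_nonneg intro!: divide_pos_pos Min_le)
    have "?m + s *\<^sub>R (x - ?m) \<in> box_face a I c"
    proof -
      have "\<bar>s * x $ i\<bar> \<le> a $ i" for i
      proof -
        have "s * \<bar>x $ i\<bar> \<le> s * (1 + \<bar>x $ i\<bar>)"
          using s(1) by simp
        also have "\<dots> \<le> a $ i"
          using s(2)[of i] by (simp add: pos_le_divide_eq add_pos_nonneg)
        finally show ?thesis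
          using s(1) by (simp add: abs_mult)
      qed
      then show ?thesis
        using x less_imp_le[OF a]
        by (auto simp: box_face_def orthobox_def face_center_def abs_le_iff minus_le_iff dest!: sign_cases[OF c])
    qed
    then have "(1 - 1 / s) *\<^sub>R ?m + (1 / s) *\<^sub>R (?m + s *\<^sub>R (x - ?m)) \<in> affine hull (box_face a I c)"
      using face_center_mem[OF c] by (intro mem_affine[OF affine_affine_hull]) (auto intro: hull_inc)
    also have "(1 - 1 / s) *\<^sub>R ?m + (1 / s) *\<^sub>R (?m + s *\<^sub>R (x - ?m)) = x"
      using s(1) by (simp add: algebra_simps)
    finally show "x \<in> affine hull (box_face a I c)" .
  qed
qed

text \<open>After translation by the centre, the affine hull is a coordinate subspace.\<close>

lemma aff_dim_box_face:
  assumes c: "c \<in> signs I"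
  shows "aff_dim (box_face a I c) = int CARD('n) - int (card I)"
proof -
  let ?V = "{x :: real^'n. \<forall>i\<in>I. x $ i = 0}" and ?m = "face_center a I c"
  have "affine hull (box_face a I c) = (+) ?m ` ?V"
  proof -
    have "x - ?m \<in> ?V" if "\<forall>i\<in>I. x $ i = c i * a $ i" for x
      using that by (simp add: face_center_def)
    then have "x \<in> (+) ?m ` ?V" if "\<forall>i\<in>I. x $ i = c i * a $ i" for x
      using that by (intro image_eqI[of _ _ "x - ?m"]) auto
    then show ?thesis
      unfolding affine_hull_box_face[OF c] by (auto simp: face_center_def)
  qed
  then have "aff_dim (box_face a I c) = aff_dim ?V"
    using aff_dim_affine_hull[of "box_face a I c"] aff_dim_translation_eq[of ?m ?V] by simp
  also have "\<dots> = int (dim ?V)"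
    by (intro aff_dim_subspace) (auto simp: subspace_def)
  also have "dim ?V = card (- I)"
  proof -
    let ?d = "(\<lambda>i. axis i 1 :: real^'n) ` (- I)"
    have "?V = {x. \<forall>b\<in>Basis. b \<notin> ?d \<longrightarrow> x \<bullet> b = 0}"
      by (auto simp: Basis_vec_def inner_axis axis_eq_axis image_iff)
    moreover have "?d \<subseteq> Basis"
      by (auto simp: Basis_vec_def)
    moreover have "card ?d = card (- I)"
      by (rule card_image) (auto simp: inj_on_def axis_eq_axis)
    ultimately show ?thesis
      by (simp only: dim_substandard)
  qed
  also have "int (card (- I)) = int CARD('n) - int (card I)"
    by (simp add: Compl_eq_Diff_UNIV card_Diff_subset card_mono of_nat_diff)
  finally show ?thesis .
qed

text \<open>The centre of a face has the value 0, never plus or minus a half-width, in the coordinates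
outside I; so I and the signs can be recovered from the face.\<close>

lemma box_face_eq_iff:
  assumes c: "c \<in> signs I" and c': "c' \<in> signs I'"
  shows "box_face a I c = box_face a I' c' \<longleftrightarrow> I = I' \<and> c = c'"
proof
  assume eq: "box_face a I c = box_face a I' c'"
  have "I \<subseteq> I' \<and> (\<forall>i\<in>I. c i = c' i)"
    if c: "c \<in> signs I" and c': "c' \<in> signs I'" and eq: "box_face a I c = box_face a I' c'"
    for I I' c c'
  proof -
    have "face_center a I' c' \<in> box_face a I c"
      using face_center_mem[OF c'] eq by simp
    then have *: "face_center a I' c' $ i = c i * a $ i" if "i \<in> I" for i
      using that by (simp add: box_face_def)
    have "i \<in> I' \<and> c i = c' i" if "i \<in> I" for i
      using *[OF that] sign_cases[OF c that] a[of i]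
      by (auto simp: face_center_def split: if_splits)
    then show ?thesis by blast
  qed
  then have "I = I'" "\<forall>i\<in>I. c i = c' i"
    using c c' eq by (metis subset_antisym)+
  moreover have "c = c'"
    using c c' calculation by (auto intro: PiE_ext)
  ultimately show "I = I' \<and> c = c'" by simp
qed simp

context
  fixes f :: "real^'n \<Rightarrow> real^'n"
  assumes f: "orthogonal_transformation f"
begin

lemma affine_hull_image_box_face:
  "c \<in> signs I \<Longrightarrow> affine hull (f ` box_face a I c) = f ` {x. \<forall>i\<in>I. x $ i = c i * a $ i}"
  using affine_hull_linear_image[of f "box_face a I c"] orthogonal_transformation_linear[OF f]
  by (simp add: linear_conv_bounded_linear affine_hull_box_face)

text \<open>The point of the affine hull nearest to the origin is the centre of the face.\<close>

lemma infdist_affine_hull_image_box_face: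
  assumes c: "c \<in> signs I"
  shows "infdist 0 (affine hull (f ` box_face a I c)) = sqrt (\<Sum>i\<in>I. (a $ i)\<^sup>2)"
proof -
  let ?m = "face_center a I c"
  have "infdist 0 (affine hull (f ` box_face a I c)) = norm (f ?m)"
    unfolding affine_hull_image_box_face[OF c]
  proof (rule infdist_0_eqI)
    show "f ?m \<in> f ` {x. \<forall>i\<in>I. x $ i = c i * a $ i}"
      by (simp add: face_center_def)
    fix y assume "y \<in> f ` {x. \<forall>i\<in>I. x $ i = c i * a $ i}"
    then obtain x where x: "y = f x" "\<forall>i\<in>I. x $ i = c i * a $ i" by blast
    have "norm ?m \<le> norm x"
      by (rule norm_le_componentwise_cart) (simp add: face_center_def x(2))
    then show "norm (f ?m) \<le> norm y"
      using x(1) f by (simp add: orthogonal_transformation_norm)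
  qed
  also have "\<dots> = norm ?m"
    using f by (rule orthogonal_transformation_norm)
  also have "\<dots> = sqrt (\<Sum>i\<in>UNIV. (?m $ i)\<^sup>2)"
    by (simp add: norm_vec_def L2_set_def)
  also have "(\<Sum>i\<in>UNIV. (?m $ i)\<^sup>2) = (\<Sum>i\<in>UNIV. if i \<in> I then (a $ i)\<^sup>2 else 0)"
    by (intro sum.cong) (auto simp: face_center_def dest: sign_cases[OF c])
  also have "\<dots> = (\<Sum>i\<in>I. (a $ i)\<^sup>2)"
    by (simp add: sum.If_cases)
  finally show ?thesis .
qed

lemma faces_of_image_orthobox:
  assumes "k \<le> CARD('n)"
  shows "{F. F face_of f ` orthobox a \<and> aff_dim F = int (CARD('n) - k)}
       = (\<lambda>(I, c). f ` box_face a I c) ` (SIGMA I:{I. card I = k}. signs I)"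
proof (intro set_eqI iffI)
  fix F assume "F \<in> {F. F face_of f ` orthobox a \<and> aff_dim F = int (CARD('n) - k)}"
  then have F: "F face_of f ` orthobox a" "aff_dim F = int (CARD('n) - k)"
    by auto
  obtain F' where F': "F = f ` F'"
    using face_of_imp_subset[OF F(1)] by (meson subset_imageE)
  have "F' face_of orthobox a"
    using F(1) F' face_of_linear_image[OF orthogonal_transformation_linear[OF f] orthogonal_transformation_inj[OF f]] by simp
  moreover have "F' \<noteq> {}"
    using F(2) F' by auto
  ultimately obtain I c where Ic: "c \<in> signs I" "F' = box_face a I c"
    using face_of_orthobox_imp_box_face by blast
  have "card I = k"
    using aff_dim_box_face[OF Ic(1)] F(2) F' Ic(2) orthogonal_transformation_linear[OF f] orthogonal_transformation_inj[OF f] assms by (simp add: of_nat_diff)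
  then show "F \<in> (\<lambda>(I, c). f ` box_face a I c) ` (SIGMA I:{I. card I = k}. signs I)"
    using Ic F' by force
next
  fix F assume "F \<in> (\<lambda>(I, c). f ` box_face a I c) ` (SIGMA I:{I. card I = k}. signs I)"
  then obtain I c where Ic: "card I = k" "c \<in> signs I" "F = f ` box_face a I c"
    by auto
  have "F face_of f ` orthobox a"
    using box_face_face_of[OF Ic(2)] Ic(3) face_of_linear_image[OF orthogonal_transformation_linear[OF f] orthogonal_transformation_inj[OF f]] by simp
  moreover have "aff_dim F = int (CARD('n) - k)"
    using aff_dim_box_face[OF Ic(2)] Ic(1,3) orthogonal_transformation_linear[OF f] orthogonal_transformation_inj[OF f] assms by (simp add: of_nat_diff)
  ultimately show "F \<in> {F. F face_of f ` orthobox a \<and> aff_dim F = int (CARD('n) - k)}"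
    by blast
qed

text \<open>The normals to the face are the images of the unit vectors with index in I, and thickening the
face in these directions gives a rotated box with the sides 2 a_i for i outside I and side 1
for i in I. Orientation of the normals is immaterial, so the box is always extended in the
positive coordinate directions.\<close>

lemma affine_volume_image_box_face:
  assumes c: "c \<in> signs I"
  shows "affine_volume (CARD('n) - card I) (f ` box_face a I c) = (\<Prod>i\<in>-I. 2 * a $ i)"
proof -
  let ?k = "card I"
  have "card I \<le> CARD('n)"
    by (rule card_mono) auto
  obtain \<tau> where \<tau>: "bij_betw \<tau> {..<?k} I"
    using ex_bij_betw_nat_finite[of I] by (auto simp: atLeast0LessThan)
  have \<tau>I: "\<tau> j \<in> I" if "j < ?k" for j
    using \<tau> that by (auto simp: bij_betw_def)
  define N where "N j = f (axis (\<tau> j) 1)" for j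
  have sum_axis: "(\<Sum>j<?k. w (\<tau> j) *\<^sub>R axis (\<tau> j) (1::real)) = (\<chi> i. if i \<in> I then w i else 0)"
    for w :: "'n \<Rightarrow> real"
  proof -
    have "(\<Sum>j<?k. w (\<tau> j) *\<^sub>R axis (\<tau> j) (1::real)) = (\<Sum>i\<in>I. w i *\<^sub>R axis i 1)"
      using sum.reindex_bij_betw[OF \<tau>, of "\<lambda>i. w i *\<^sub>R axis i (1::real)"] .
    then show ?thesis
      by (simp add: vec_eq_iff axis_def if_distrib[of "\<lambda>c. _ * c"] sum.delta' cong: if_cong)
  qed
  have f_sum: "f (y + (\<Sum>j<?k. w (\<tau> j) *\<^sub>R axis (\<tau> j) 1)) = f y + (\<Sum>j<?k. w (\<tau> j) *\<^sub>R N j)" for y w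
    using orthogonal_transformation_linear[OF f] by (simp add: linear_add linear_sum linear_cmul N_def)
  define l where "l = (\<chi> i. if i \<in> I then c i * a $ i else - a $ i)"
  define u where "u = (\<chi> i. if i \<in> I then c i * a $ i + 1 else a $ i)"
  have cbox: "x \<in> cbox l u \<longleftrightarrow> (\<forall>i. if i \<in> I then c i * a $ i \<le> x $ i \<and> x $ i \<le> c i * a $ i + 1
      else - a $ i \<le> x $ i \<and> x $ i \<le> a $ i)" for x
    by (auto simp: mem_box_cart l_def u_def)
  have prism: "f ` cbox l u = {s + (\<Sum>j<?k. t j *\<^sub>R N j) | s t.
      s \<in> f ` box_face a I c \<and> (\<forall>j<?k. 0 \<le> t j \<and> t j \<le> 1)}" (is "_ = ?Q")
  proof
    show "f ` cbox l u \<subseteq> ?Q"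
    proof
      fix z assume "z \<in> f ` cbox l u"
      then obtain x where x: "z = f x" "x \<in> cbox l u" by blast
      define y where "y = (\<chi> i. if i \<in> I then c i * a $ i else x $ i)"
      define w where "w i = x $ i - c i * a $ i" for i
      have "x = y + (\<Sum>j<?k. w (\<tau> j) *\<^sub>R axis (\<tau> j) 1)"
        unfolding sum_axis by (simp add: vec_eq_iff y_def w_def)
      then have "z = f y + (\<Sum>j<?k. w (\<tau> j) *\<^sub>R N j)"
        using f_sum x(1) by simp
      moreover have "y \<in> box_face a I c"
      proof -
        have "- a $ i \<le> y $ i \<and> y $ i \<le> a $ i" for i
          using x(2) less_imp_le[OF a[of i]] unfolding cbox
          by (cases "i \<in> I") (auto simp: y_def dest!: sign_cases[OF c] spec[of _ i])
        then show ?thesis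
          by (simp add: box_face_def orthobox_def y_def)
      qed
      moreover have "\<forall>j<?k. 0 \<le> w (\<tau> j) \<and> w (\<tau> j) \<le> 1"
      proof (intro allI impI)
        fix j assume "j < ?k"
        then show "0 \<le> w (\<tau> j) \<and> w (\<tau> j) \<le> 1"
          using x(2) \<tau>I[of j] unfolding cbox w_def by (auto dest!: spec[of _ "\<tau> j"])
      qed
      ultimately show "z \<in> ?Q"
        by (intro CollectI exI[of _ "f y"] exI[of _ "\<lambda>j. w (\<tau> j)"]) simp
    qed
    show "?Q \<subseteq> f ` cbox l u"
    proof
      fix z assume "z \<in> ?Q"
      then obtain y t where z: "z = f y + (\<Sum>j<?k. t j *\<^sub>R N j)" "y \<in> box_face a I c"
          "\<forall>j<?k. 0 \<le> t j \<and> t j \<le> 1"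
        by blast
      define w where "w i = t (inv_into {..<?k} \<tau> i)" for i
      have w: "w (\<tau> j) = t j" if "j < ?k" for j
        using \<tau> that by (simp add: w_def bij_betw_def inv_into_f_f)
      have "0 \<le> w i \<and> w i \<le> 1" if i: "i \<in> I" for i
      proof -
        obtain j where "j < ?k" "i = \<tau> j"
          using \<tau> i by (auto simp: bij_betw_def)
        then show ?thesis
          using z(3) w by simp
      qed
      then have "y + (\<Sum>j<?k. w (\<tau> j) *\<^sub>R axis (\<tau> j) 1) \<in> cbox l u"
        using z(2) unfolding sum_axis cbox by (auto simp: box_face_def orthobox_def)
      moreover have "z = f (y + (\<Sum>j<?k. w (\<tau> j) *\<^sub>R axis (\<tau> j) 1))"
        unfolding f_sum z(1) by (simp add: w)
      ultimately show "z \<in> f ` cbox l u"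
        by blast
    qed
  qed
  have "compact (box_face a I c)"
    using box_face_face_of[OF c] by (rule face_of_imp_compact[rotated 2]) (simp_all add: orthobox_eq_cbox)
  then have "compact (f ` box_face a I c)" "compact (f ` cbox l u)"
    using orthogonal_transformation_linear[OF f] by (auto intro!: compact_continuous_image simp: linear_continuous_on linear_conv_bounded_linear)
  then have borel: "f ` box_face a I c \<in> sets borel" "f ` cbox l u \<in> sets borel"
    by (auto intro: borel_compact)
  have "affine_volume (CARD('n) - ?k) (f ` box_face a I c) = measure lborel (f ` cbox l u)"
  proof (rule affine_volume_eq_measure_prism[where k = ?k and N = N])
    show "aff_dim (f ` box_face a I c) = int (CARD('n) - ?k)"
      using aff_dim_box_face[OF c] orthogonal_transformation_linear[OF f] orthogonal_transformation_inj[OF f] \<open>card I \<le> CARD('n)\<close> by (simp add: of_nat_diff)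
    show "CARD('n) - ?k + ?k = DIM(real^'n)"
      using \<open>card I \<le> CARD('n)\<close> by simp
    show "N i \<bullet> N j = (if i = j then 1 else 0)" if "i < ?k" "j < ?k" for i j
    proof -
      have "\<tau> i = \<tau> j \<longleftrightarrow> i = j"
        using \<tau> that by (auto simp: bij_betw_def inj_on_def)
      then show ?thesis
        using f by (simp add: N_def orthogonal_transformation_def inner_axis_axis)
    qed
    show "N j \<bullet> x = N j \<bullet> y"
      if "x \<in> affine hull (f ` box_face a I c)" "y \<in> affine hull (f ` box_face a I c)" "j < ?k" for x y j
      using that(1,2) \<tau>I[OF that(3)] f unfolding affine_hull_image_box_face[OF c]
      by (auto simp: N_def orthogonal_transformation_def inner_axis')
  qed (use borel prism in auto)
  also have "\<dots> = measure lborel (cbox l u)"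
    by (rule measure_orthogonal_image_lborel[OF f]) simp
  also have "\<dots> = (\<Prod>i\<in>UNIV. u $ i - l $ i)"
  proof (rule content_cbox_cart)
    have "l $ i \<le> u $ i" for i
      using less_imp_le[OF a[of i]] by (simp add: l_def u_def)
    then show "cbox l u \<noteq> {}"
      by (simp add: interval_ne_empty_cart)
  qed
  also have "\<dots> = (\<Prod>i\<in>UNIV. if i \<in> - I then 2 * a $ i else 1)"
    by (intro prod.cong) (auto simp: l_def u_def)
  also have "\<dots> = (\<Prod>i\<in>-I. 2 * a $ i)"
    by (simp add: prod.If_cases Compl_eq)
  finally show ?thesis .
qed

text \<open>There are 2^k parallel faces for each set I of k fixed coordinates.\<close>

lemma total_face_measure_orthotope:
  assumes "k \<le> CARD('n)"
  shows "total_face_measure (CARD('n) - k) (f ` orthobox a)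
       = (\<Sum>I | card I = k. 2 ^ k * (\<Prod>i\<in>-I. 2 * a $ i))"
proof -
  let ?d = "CARD('n) - k"
  let ?K = "SIGMA I:{I :: 'n set. card I = k}. signs I"
  have inj: "inj_on (\<lambda>(I, c). f ` box_face a I c) ?K"
    using orthogonal_transformation_inj[OF f] by (auto simp: inj_on_def inj_image_eq_iff box_face_eq_iff)
  have "total_face_measure ?d (f ` orthobox a) = (\<Sum>(I, c)\<in>?K. affine_volume ?d (f ` box_face a I c))"
    unfolding total_face_measure_def faces_of_image_orthobox[OF assms]
    using sum.reindex[OF inj, of "affine_volume ?d"] by (simp add: case_prod_beta comp_def)
  also have "\<dots> = (\<Sum>(I, c)\<in>?K. \<Prod>i\<in>-I. 2 * a $ i)"
    using affine_volume_image_box_face by (intro sum.cong) auto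
  also have "\<dots> = (\<Sum>I | card I = k. \<Sum>c\<in>signs I. \<Prod>i\<in>-I. 2 * a $ i)"
    by (subst sum.Sigma) (auto intro!: finite_PiE)
  also have "\<dots> = (\<Sum>I | card I = k. 2 ^ k * (\<Prod>i\<in>-I. 2 * a $ i))"
    by (intro sum.cong) (auto simp: card_PiE)
  finally show ?thesis .
qed

end

end

lemma total_face_measure_cube:
  fixes f :: "real^'n \<Rightarrow> real^'n"
  assumes "orthogonal_transformation f" "k \<le> CARD('n)"
  shows "total_face_measure (CARD('n) - k) (f ` orthobox 1) = 2 ^ CARD('n) * real (CARD('n) choose k)"
proof -
  have "total_face_measure (CARD('n) - k) (f ` orthobox 1) = (\<Sum>I | card I = k. 2 ^ k * (\<Prod>i\<in>-I. 2 * (1 :: real^'n) $ i))"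
    using assms by (intro total_face_measure_orthotope) auto
  also have "\<dots> = (\<Sum>I :: 'n set | card I = k. 2 ^ CARD('n))"
    using assms(2) by (intro sum.cong) (auto simp: Compl_eq_Diff_UNIV card_Diff_subset power_add[symmetric])
  also have "\<dots> = 2 ^ CARD('n) * real (CARD('n) choose k)"
    using n_subsets[of "UNIV :: 'n set" k] by simp
  finally show ?thesis .
qed

section \<open>Admissible orthotopes and the cube\<close>

text \<open>The half-width a_i is the distance from the origin to a facet, so this is admissibility in
codimension one.\<close>

lemma admissible_orthotope_half_width_ge_1:
  fixes a :: "real^'n" and f :: "real^'n \<Rightarrow> real^'n"
  assumes adm: "admissible (f ` orthobox a)" and a: "\<And>i. 0 < a $ i"
    and f: "orthogonal_transformation f"
  shows "1 \<le> a $ i"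
proof -
  define c :: "'n \<Rightarrow> real" where "c = restrict (\<lambda>_. 1) {i}"
  have c: "c \<in> signs {i}"
    by (simp add: c_def)
  let ?F = "f ` box_face a {i} c"
  have lin: "linear f" "inj f"
    using orthogonal_transformation_linear[OF f] orthogonal_transformation_inj[OF f] .
  have "?F face_of f ` orthobox a"
    using face_of_linear_image[OF lin] box_face_face_of[OF a c] by simp
  moreover have "aff_dim ?F = int CARD('n) - int 1"
    using aff_dim_box_face[OF a c] lin by simp
  moreover have "?F \<noteq> {}"
    using face_center_mem[OF a c] by blast
  moreover have "?F \<noteq> f ` orthobox a"
    using adm \<open>aff_dim ?F = int CARD('n) - int 1\<close> by (auto simp: admissible_def)
  moreover have "1 \<in> {1..CARD('n)}"
    by (simp add: Suc_le_eq)
  ultimately have "sqrt (real 1) \<le> infdist 0 (affine hull ?F)"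
    using adm unfolding admissible_def by blast
  then show ?thesis
    using infdist_affine_hull_image_box_face[OF a f c] less_imp_le[OF a[of i]] by simp
qed

text \<open>The formula for the total face measure is monotone in the half-widths.\<close>

lemma total_face_measure_orthotope_ge:
  fixes a :: "real^'n" and f :: "real^'n \<Rightarrow> real^'n"
  assumes a: "\<And>i. 1 \<le> a $ i" and f: "orthogonal_transformation f" and k: "k \<le> CARD('n)"
  shows "2 ^ CARD('n) * real (CARD('n) choose k) \<le> total_face_measure (CARD('n) - k) (f ` orthobox a)"
proof -
  have pos: "0 < a $ i" for i
    using a[of i] by linarith
  have "2 ^ CARD('n) * real (CARD('n) choose k) = (\<Sum>I :: 'n set | card I = k. 2 ^ k * (\<Prod>i\<in>-I. 2 * (1 :: real^'n) $ i))"
    using total_face_measure_cube[OF f k] total_face_measure_orthotope[of 1, OF _ f k] by simp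
  also have "\<dots> \<le> (\<Sum>I | card I = k. 2 ^ k * (\<Prod>i\<in>-I. 2 * a $ i))"
    using a by (intro sum_mono mult_left_mono prod_mono) auto
  also have "\<dots> = total_face_measure (CARD('n) - k) (f ` orthobox a)"
    using total_face_measure_orthotope[OF pos f k] by simp
  finally show ?thesis .
qed

text \<open>Rigidity of the symmetric case: mapping the standard basis to the orthonormal facet normals
takes the standard cube to P.\<close>

lemma admissible_symmetric_imp_rotated_cube:
  fixes P :: "(real^'n) set"
  assumes n: "2 \<le> CARD('n)" and adm: "admissible P" and sym: "symmetric_with_unit_facets P"
  obtains f :: "real^'n \<Rightarrow> real^'n" where "orthogonal_transformation f" "P = f ` orthobox 1"
proof -
  have P: "polyhedron P" "compact P" "aff_dim P = int CARD('n)" "0 \<in> interior P"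
    using adm by (auto simp: admissible_def)
  interpret nonobtuse_unit_facet_polytope P
  proof
    show "infdist 0 (affine hull F) = 1" if "F facet_of P" for F
      using sym that by (auto simp: symmetric_with_unit_facets_def)
    show "sqrt 2 \<le> infdist 0 (affine hull F)"
      if F: "F face_of P" "F \<noteq> {}" "aff_dim F = int DIM(real^'n) - 2" for F
    proof -
      have "F \<noteq> P"
        using F(3) P(3) by auto
      moreover have "aff_dim F = int CARD('n) - int 2" "2 \<in> {1..CARD('n)}"
        using F(3) n by auto
      ultimately have "sqrt (real 2) \<le> infdist 0 (affine hull F)"
        using adm F(1,2) unfolding admissible_def by blast
      then show ?thesis by simp
    qed
  qed (use P interior_subset in \<open>auto intro: compact_imp_bounded\<close>)
  have "P = uminus ` P"
    using sym by (simp add: symmetric_with_unit_facets_def)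
  then obtain B where B: "card B = CARD('n)"
      "\<And>b c. b \<in> B \<Longrightarrow> c \<in> B \<Longrightarrow> b \<bullet> c = (if b = c then 1 else 0)"
      "\<And>x. x \<in> P \<longleftrightarrow> (\<forall>b\<in>B. \<bar>b \<bullet> x\<bar> \<le> 1)"
    using symmetric_imp_orthonormal_frame by (metis DIM_cart DIM_real mult.right_neutral)
  have "finite B"
    using B(1) by (metis card.infinite card_0_eq finite UNIV_not_empty)
  then obtain e :: "'n \<Rightarrow> real^'n" where e: "bij_betw e UNIV B"
    using finite_same_card_bij[of "UNIV :: 'n set" B] B(1) by auto
  have ee: "e i \<bullet> e j = (if i = j then 1 else 0)" for i j
    using B(2)[of "e i" "e j"] e by (auto simp: bij_betw_def inj_on_def)
  define f where "f x = (\<Sum>i\<in>UNIV. x $ i *\<^sub>R e i)" for x :: "real^'n"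
  have f: "orthogonal_transformation f"
    unfolding orthogonal_transformation_def
  proof (intro conjI allI)
    show "linear f"
      by (rule linearI) (simp_all add: f_def scaleR_add_left sum.distrib scaleR_sum_right)
    show "f v \<bullet> f w = v \<bullet> w" for v w
    proof -
      have "f v \<bullet> f w = (\<Sum>i\<in>UNIV. v $ i * w $ i)"
        by (simp add: f_def inner_sum_left inner_sum_right ee mult.commute
            if_distrib[of "\<lambda>c. _ * c"] cong: if_cong)
      then show ?thesis
        by (simp add: inner_vec_def)
    qed
  qed
  have "e i \<bullet> f x = x $ i" for i x
    by (simp add: f_def inner_sum_right ee if_distrib[of "\<lambda>c. _ * c"] cong: if_cong)
  then have "f x \<in> P \<longleftrightarrow> x \<in> orthobox 1" for x
    unfolding B(3) using e by (auto simp: orthobox_def bij_betw_def abs_le_iff minus_le_iff)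
  then have "P = f ` orthobox 1"
    using orthogonal_transformation_surj[OF f] by (metis (no_types, lifting) image_subset_iff subsetI subset_antisym surjD image_eqI)
  then show ?thesis
    using f that by blast
qed

lemma standard_cube_eq_orthobox: "standard_cube = orthobox 1"
  by (simp add: standard_cube_def orthobox_def)

text \<open>The cube meets the admissibility bounds with equality in every codimension; facets (k = 1)
give the distance one needed for the symmetric case.\<close>

lemma infdist_affine_hull_standard_cube_face:
  fixes F :: "(real^'n) set"
  assumes F: "F face_of standard_cube" "F \<noteq> {}" "aff_dim F = int CARD('n) - int k"
  shows "infdist 0 (affine hull F) = sqrt (real k)"
proof -
  have pos: "0 < (1 :: real^'n) $ i" for i
    by simp
  obtain I c where Ic: "c \<in> signs I" "F = box_face 1 I c"
    using face_of_orthobox_imp_box_face[OF pos] F(1,2) standard_cube_eq_orthobox by metis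
  have "card I = k"
    using aff_dim_box_face[OF pos Ic(1)] Ic(2) F(3) by simp
  then show ?thesis
    using infdist_affine_hull_image_box_face[OF pos orthogonal_transformation_id Ic(1)] Ic(2) by simp
qed

lemma aff_dim_standard_cube: "aff_dim (standard_cube :: (real^'n) set) = int CARD('n)"
  and zero_interior_standard_cube: "0 \<in> interior (standard_cube :: (real^'n) set)"
proof -
  have "0 \<in> box (- 1) (1 :: real^'n)"
    by (simp add: mem_box_cart)
  then show "0 \<in> interior (standard_cube :: (real^'n) set)"
    by (simp add: standard_cube_eq_orthobox orthobox_eq_cbox)
  then show "aff_dim (standard_cube :: (real^'n) set) = int CARD('n)"
    using aff_dim_nonempty_interior[of "standard_cube :: (real^'n) set"] by auto
qed

lemma admissible_standard_cube: "admissible (standard_cube :: (real^'n) set)"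
  unfolding admissible_def
proof (intro conjI ballI allI impI)
  show "polyhedron (standard_cube :: (real^'n) set)" "compact (standard_cube :: (real^'n) set)"
    by (simp_all add: standard_cube_eq_orthobox orthobox_eq_cbox polytope_interval polytope_imp_polyhedron)
  fix k and F :: "(real^'n) set"
  assume "F face_of standard_cube \<and> F \<noteq> {} \<and> F \<noteq> standard_cube \<and> aff_dim F = int CARD('n) - int k"
  then show "sqrt (real k) \<le> infdist 0 (affine hull F)"
    using infdist_affine_hull_standard_cube_face[of F k] by simp
qed (rule aff_dim_standard_cube zero_interior_standard_cube)+

lemma centered_orthotope_standard_cube: "centered_orthotope (standard_cube :: (real^'n) set)"
  unfolding centered_orthotope_def
  by (intro exI[of _ "\<lambda>x. x"] exI[of _ 1]) (auto simp: standard_cube_def)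

lemma symmetric_standard_cube: "symmetric_with_unit_facets (standard_cube :: (real^'n) set)"
  unfolding symmetric_with_unit_facets_def
proof (intro conjI allI impI)
  show "standard_cube = uminus ` (standard_cube :: (real^'n) set)"
  proof -
    have "x \<in> uminus ` standard_cube" if "x \<in> standard_cube" for x :: "real^'n"
      using that by (intro image_eqI[of _ _ "- x"]) (auto simp: standard_cube_def minus_le_iff)
    then show ?thesis
      by (auto simp: standard_cube_def minus_le_iff)
  qed
  fix F :: "(real^'n) set" assume "F facet_of standard_cube"
  then show "infdist 0 (affine hull F) = 1"
    using infdist_affine_hull_standard_cube_face[of F 1]
    by (simp add: facet_of_def aff_dim_standard_cube)
qed

theorem proposition5p3:
  assumes "CARD('n::finite) \<ge> 3"
  shows "(\<forall>P :: (real^'n) set.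
            admissible P \<and> (centered_orthotope P \<or> symmetric_with_unit_facets P) \<longrightarrow>
              total_face_measure (CARD('n) - 2) P \<ge> 2 ^ CARD('n) * real (CARD('n) choose 2))
       \<and> 2 ^ CARD('n) * real (CARD('n) choose 2)
           = real CARD('n) * (real CARD('n) - 1) * 2 ^ (CARD('n) - 1)
       \<and> admissible (standard_cube :: (real^'n) set)
       \<and> centered_orthotope (standard_cube :: (real^'n) set)
       \<and> symmetric_with_unit_facets (standard_cube :: (real^'n) set)
       \<and> total_face_measure (CARD('n) - 2) (standard_cube :: (real^'n) set)
           = 2 ^ CARD('n) * real (CARD('n) choose 2)"
proof (intro conjI allI impI)
  have n: "2 \<le> CARD('n)"
    using assms by simp
  fix P :: "(real^'n) set"
  assume P: "admissible P \<and> (centered_orthotope P \<or> symmetric_with_unit_facets P)"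
  show "total_face_measure (CARD('n) - 2) P \<ge> 2 ^ CARD('n) * real (CARD('n) choose 2)"
  proof (cases "centered_orthotope P")
    case True
    then obtain f :: "real^'n \<Rightarrow> real^'n" and a where
      fa: "orthogonal_transformation f" "\<And>i. 0 < a $ i" "P = f ` orthobox a"
      unfolding centered_orthotope_def orthobox_def by blast
    then show ?thesis
      using P admissible_orthotope_half_width_ge_1[of f a] total_face_measure_orthotope_ge[OF _ fa(1) n]
      by blast
  next
    case False
    then obtain f :: "real^'n \<Rightarrow> real^'n" where f: "orthogonal_transformation f" "P = f ` orthobox 1"
      using P admissible_symmetric_imp_rotated_cube[OF n] by blast
    show ?thesis
      unfolding f(2) using total_face_measure_cube[OF f(1) n] by simp
  qed
next
  obtain m where m: "CARD('n) = Suc m"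
    by (metis zero_less_card_finite gr0_implies_Suc)
  have "real (2 * (Suc m choose 2)) = real (Suc m * m)"
    by (subst choose_two) simp
  then have "2 * real (Suc m choose 2) = real (Suc m) * real m"
    by (simp only: of_nat_mult of_nat_numeral)
  then show "2 ^ CARD('n) * real (CARD('n) choose 2)
      = real CARD('n) * (real CARD('n) - 1) * 2 ^ (CARD('n) - 1)"
    unfolding m by simp
next
  have "2 \<le> CARD('n)"
    using assms by simp
  then show "total_face_measure (CARD('n) - 2) (standard_cube :: (real^'n) set)
      = 2 ^ CARD('n) * real (CARD('n) choose 2)"
    using total_face_measure_cube[OF orthogonal_transformation_id, of 2] by (simp add: standard_cube_eq_orthobox)
qed (rule admissible_standard_cube centered_orthotope_standard_cube symmetric_standard_cube)+

end
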